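(* Let $p^\pm_A$ and $F^\pm_{R|a}$ satisfy Assumptions (I), (II) and (III) of the context, and consider the corresponding multifractal embedded branching process (MEBP), with its crossings $C^n_k$ and their marks $(\alpha^n_k,Z^n_k,A^n_k,R^n_k)$, $n\in\mathbb Z$, $k\ge1$. For $n\ge m$ and $k\ge1$ let $\kappa(m,n,k)$ be such that $C^m_k$ is a subcrossing (descendant) of $C^n_{\kappa(m,n,k)}$, and let $S^n_k\in\{1,\dots,Z^{n+1}_{\kappa(n,n+1,k)}\}$ be the position of $C^n_k$ among the children of $C^{n+1}_{\kappa(n,n+1,k)}$. For $n\ge0$, $k\ge1$ put $$\mathcal Y^n(k)=\big(\kappa(0,n,k),\ S^n_{\kappa(0,n,k)},\ Z^{n+1}_{\kappa(0,n+1,k)},\ A^{n+1}_{\kappa(0,n+1,k)},\ R^{n+1}_{\kappa(0,n+1,k)}\big),$$ let $N(k)$ be the smallest $n\ge0$ such that $\kappa(0,n+1,k)=1$, and put $$\mathcal Y(k)=\big(\mathcal Y^0(k),\dots,\mathcal Y^{N(k)}(k)\big).$$ Then $\mathcal Y=(\mathcal Y(k))_{k\ge1}$ is a Markov process.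
   Context: Crossings. Let $Y:\mathbb R_+\to\mathbb R$ be continuous with $Y(0)=0$. For $n\in\mathbb Z$ put $\mathcal T^n_0=0$ and $\mathcal T^n_{k+1}=\inf\{t>\mathcal T^n_k: Y(t)\in2^n\mathbb Z,\ Y(t)\ne Y(\mathcal T^n_k)\}$. For $k\ge1$ the $k$th level $n$ crossing $C^n_k$ is the path from $\mathcal T^n_{k-1}$ to $\mathcal T^n_k$; its orientation $\alpha^n_k\in\{+,-\}$ is the sign of $Y(\mathcal T^n_k)-Y(\mathcal T^n_{k-1})=\pm2^n$. Each level $n$ crossing decomposes into finitely many consecutive level $n-1$ crossings (its children); $A^n_k$ is the vector of their orientations, in order, and $Z^n_k=|A^n_k|$ their number. Orientation distributions. $\mathcal A$ is the set of finite vectors consisting of some number (possibly zero) of pairs, each $+-$ or $-+$, followed by one final pair $++$ (if the parent crossing is $+$) or $--$ (if the parent crossing is $-$). $p^+_A$ (resp. $p^-_A$) is a probability distribution on $\mathcal A$ supported on vectors ending in $++$ (resp. $--$). For $a\in\mathcal A$, $|a|$ is its length, $a(j)$ its $j$th entry, $z^\pm(a)$ the number of $\pm$ entries. $\mu^\pm=\sum_a|a|p^\pm_A(a)$. Weights. $F^i_{R|a}$ is a probability distribution function on $\mathbb R_+^{|a|}$, for $i=\pm$ and $a\in\mathcal A$. To each crossing $C^n_k$ there is attached a weight vector $R^n_k=(R^n_k(1),\dots,R^n_k(Z^n_k))$, one weight per child; given $\alpha^n_k=i$ and $A^n_k=a$, $R^n_k$ has distribution $F^i_{R|a}$. Write $(\alpha_\varnothing,A_\varnothing,R_\varnothing)$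 for the orientation, offspring orientations and weights of a generic crossing, and $Z_\varnothing=|A_\varnothing|$. Law of the marked crossing tree of the MEBP. Conditioned on the orientation of a crossing, its pair $(A,R)$ is independent of the pairs of all crossings that are not its descendants. Let $u=p^+_A(\{a:a(1)=+\})$, $v=p^-_A(\{a:a(1)=+\})$, and $a_*=v/(1-u+v)$ (or $a_*\in[0,1]$ arbitrary but fixed if $(u,v)=(1,0)$). For every $N\in\mathbb Z$, the tree of descendants of the first level $N$ crossing $C^N_1$, with each node marked by its $(\alpha,A,R)$, is a two-type Galton–Watson tree whose root has type $+$ with probability $a_*$ and $-$ otherwise, and in which, given its type $i$, a node has offspring types $A$ with law $p^i_A$ and weights $R$ with law $F^i_{R|A}$; $C^N_1$ is the first child of $C^{N+1}_1$ for every $N$, and every crossing is a descendant of $C^N_1$ for $N$ large enough. The MEBP defined by $p^\pm_A,F^\pm_{R|a}$ is a continuous process on $\mathbb R_+$ whose crossing tree carries these marks (its crossing durations are determined by the weights; the precise form of the durations is not needed for the definition of $\mathcal Y$). Matrices. For $\theta\ge0$ and $i,j\in\{+,-\}$ let $m_{i,j}(\theta)=\mathbb E\big(\sum_{1\le k\le Z_\varnothing,\,A_\varnothing(k)=j}R_\varnothing(k)^\theta\,\big|\,\alpha_\varnothing=i\big)$, $M(\theta)=(m_{i,j}(\theta))_{i,j=\pm}$, and let $\mu(\theta)$ be the largest eigenvalue of $M(\theta)$. Assumption (I). $\mu^+,\mu^->2$ and $\sum_a p^j_A(a)z^i(a)\log z^i(a)<\infty$ for $i,j=\pm$. Assumption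 (II). $0<R_\varnothing<\infty$ a.s. (componentwise), $M(\theta)<\infty$ in an open neighbourhood of $1$, $\mu(1)=1$ and $\mu'(1)<0$. In the case where the distribution of $R_\varnothing$ (and thus $Z_\varnothing$) does not depend on $\alpha_\varnothing$, in addition $\mathbb E\big(\sum_{j=1}^{Z_\varnothing}R_\varnothing(j)\,\log\sum_{j=1}^{Z_\varnothing}R_\varnothing(j)\big)<\infty$. In the case where there is dependence on $\alpha_\varnothing$, in addition for some $\delta>1$, $\mu(\delta)<1$ and $\mathbb E\big(\big(\sum_{j=1}^{Z_\varnothing}R_\varnothing(j)\big)^\delta\mid\alpha_\varnothing=i\big)<\infty$ for $i=\pm$. Assumption (III). If $u\ne1$ and $v\ne0$, then $\frac1{1-u}\mathbb E(\log R_\varnothing(1)\mid\alpha_\varnothing=+)+\frac1v\mathbb E(\log R_\varnothing(1)\mid\alpha_\varnothing=-)<0$. If $u=1$, then $\mathbb E(\log R_\varnothing(1)\mid\alpha_\varnothing=+)<0$; if $v=0$, then $\mathbb E(\log R_\varnothing(1)\mid\alpha_\varnothing=-)<0$. *)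

theory Defs
  imports
    "HOL-Probability.Probability"
    "HOL-Library.Sublist"
    "Jordan_Normal_Form.Char_Poly"
begin

section \<open>Crossings of a path\<close>

datatype orient = Up | Down

text \<open>
  Paths are functions \<open>y :: real \<Rightarrow> real\<close> of which only the values on the nonnegative
  half-line matter. All crossings are numbered from 1; \<open>crossing_time y n 0 = 0\<close>.
\<close>

definition dyadic_grid :: "int \<Rightarrow> real set" where
  "dyadic_grid n = {2 powi n * of_int z |z. True}"

text \<open>
  The infimum is only meaningful for a nonempty set; nonemptiness is required of the processes
  considered below (see \<open>mebp\<close>).
\<close>

primrec crossing_time :: "(real \<Rightarrow> real) \<Rightarrow> int \<Rightarrow> nat \<Rightarrow> real" where
  "crossing_time y n 0 = 0"
| "crossing_time y n (Suc k) =
     Inf {t. t > crossing_time y n k \<and> y t \<in> dyadic_grid n \<and> y t \<noteq> y (crossing_time y n k)}"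

definition crossings_exist :: "(real \<Rightarrow> real) \<Rightarrow> bool" where
  "crossings_exist y \<longleftrightarrow>
     (\<forall>n k. \<exists>t > crossing_time y n k. y t \<in> dyadic_grid n \<and> y t \<noteq> y (crossing_time y n k))"

definition crossing_orient :: "(real \<Rightarrow> real) \<Rightarrow> int \<Rightarrow> nat \<Rightarrow> orient" where
  "crossing_orient y n k =
     (if y (crossing_time y n k) - y (crossing_time y n (k - 1)) > 0 then Up else Down)"

text \<open>\<open>subcrossing y m j n k\<close>: the crossing \<open>j\<close> of level \<open>m\<close> is part of the crossing \<open>k\<close> of level \<open>n\<close>.\<close>

definition subcrossing :: "(real \<Rightarrow> real) \<Rightarrow> int \<Rightarrow> nat \<Rightarrow> int \<Rightarrow> nat \<Rightarrow> bool" where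
  "subcrossing y m j n k \<longleftrightarrow> 1 \<le> j \<and> 1 \<le> k \<and>
     crossing_time y n (k - 1) \<le> crossing_time y m (j - 1) \<and>
     crossing_time y m j \<le> crossing_time y n k"

definition children :: "(real \<Rightarrow> real) \<Rightarrow> int \<Rightarrow> nat \<Rightarrow> nat set" where
  "children y n k = {j. subcrossing y (n - 1) j n k}"

definition offspring :: "(real \<Rightarrow> real) \<Rightarrow> int \<Rightarrow> nat \<Rightarrow> orient list" where
  "offspring y n k = map (crossing_orient y (n - 1)) (sorted_list_of_set (children y n k))"

definition num_offspring :: "(real \<Rightarrow> real) \<Rightarrow> int \<Rightarrow> nat \<Rightarrow> nat" where
  "num_offspring y n k = length (offspring y n k)"

definition ancestor :: "(real \<Rightarrow> real) \<Rightarrow> int \<Rightarrow> int \<Rightarrow> nat \<Rightarrow> nat" where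
  "ancestor y m n k = (THE j. subcrossing y m k n j)"

definition position :: "(real \<Rightarrow> real) \<Rightarrow> int \<Rightarrow> nat \<Rightarrow> nat" where
  "position y n k = card {j \<in> children y (n + 1) (ancestor y n (n + 1) k). j \<le> k}"

text \<open>
  Ulam--Harris addresses: \<open>descendant y n k [j\<^sub>1, \<dots>, j\<^sub>l]\<close> is the number, within level \<open>n - l\<close>, of
  the \<open>j\<^sub>l\<close>-th child of the \<dots> of the \<open>j\<^sub>1\<close>-th child of the crossing \<open>k\<close> of level \<open>n\<close>; it is
  \<^const>\<open>None\<close> if there is no such crossing.
\<close>

fun descendant :: "(real \<Rightarrow> real) \<Rightarrow> int \<Rightarrow> nat \<Rightarrow> nat list \<Rightarrow> nat option" where
  "descendant y n k [] = Some k"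
| "descendant y n k (j # \<sigma>) =
     (if 1 \<le> j \<and> j \<le> num_offspring y n k
      then descendant y (n - 1) (sorted_list_of_set (children y n k) ! (j - 1)) \<sigma> else None)"


section \<open>Measurable spaces of lists and marks\<close>

text \<open>
  The disjoint union of the finite powers of a measurable space: the sigma-algebra is generated by the
  boxes \<open>A\<^sub>1 \<times> \<dots> \<times> A\<^sub>n\<close>. In particular \<open>list_space borel\<close> restricted to the lists of
  length \<open>n\<close> is the Borel sigma-algebra of \<open>n\<close>-dimensional Euclidean space.
\<close>

definition list_space :: "'a measure \<Rightarrow> 'a list measure" where
  "list_space S = sigma (lists (space S)) {listset As |As. set As \<subseteq> sets S}"

type_synonym mark = "orient \<times> orient list \<times> real list"

definition mark_space :: "mark measure" where
  "mark_space = count_space UNIV \<Otimes>\<^sub>M count_space UNIV \<Otimes>\<^sub>M list_space borel"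


section \<open>Offspring and weight distributions\<close>

definition offspring_vectors :: "orient \<Rightarrow> orient list set" where
  "offspring_vectors i = {concat ps @ [i, i] |ps. set ps \<subseteq> {[Up, Down], [Down, Up]}}"

definition orientation_distributions :: "(orient \<Rightarrow> orient list pmf) \<Rightarrow> bool" where
  "orientation_distributions p \<longleftrightarrow> (\<forall>i. set_pmf (p i) \<subseteq> offspring_vectors i)"

definition weight_distributions :: "(orient \<Rightarrow> orient list \<Rightarrow> real list measure) \<Rightarrow> bool" where
  "weight_distributions F \<longleftrightarrow> (\<forall>i. \<forall>a \<in> offspring_vectors Up \<union> offspring_vectors Down.
     prob_space (F i a) \<and> sets (F i a) = sets (list_space borel) \<and>
     (AE r in F i a. length r = length a \<and> (\<forall>x \<in> set r. 0 \<le> x)))"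

text \<open>
  Expectation of \<open>g A R\<close> for a generic crossing, conditional on its orientation being \<open>i\<close>. The signed
  version has values in the extended reals, so that expectations that are \<open>- \<infinity>\<close> are not confused
  with 0; it is only meaningful if one of the two parts is finite.
\<close>

definition cond_nn_expect ::
  "(orient \<Rightarrow> orient list pmf) \<Rightarrow> (orient \<Rightarrow> orient list \<Rightarrow> real list measure) \<Rightarrow> orient
    \<Rightarrow> (orient list \<Rightarrow> real list \<Rightarrow> ennreal) \<Rightarrow> ennreal" where
  "cond_nn_expect p F i g = (\<integral>\<^sup>+ a. (\<integral>\<^sup>+ r. g a r \<partial>F i a) \<partial>measure_pmf (p i))"

definition cond_expect ::
  "(orient \<Rightarrow> orient list pmf) \<Rightarrow> (orient \<Rightarrow> orient list \<Rightarrow> real list measure) \<Rightarrow> orient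
    \<Rightarrow> (orient list \<Rightarrow> real list \<Rightarrow> real) \<Rightarrow> ereal" where
  "cond_expect p F i g =
     enn2ereal (cond_nn_expect p F i (\<lambda>a r. ennreal (g a r))) -
     enn2ereal (cond_nn_expect p F i (\<lambda>a r. ennreal (- g a r)))"

definition cond_weight_law ::
  "(orient \<Rightarrow> orient list pmf) \<Rightarrow> (orient \<Rightarrow> orient list \<Rightarrow> real list measure) \<Rightarrow> orient
    \<Rightarrow> real list set \<Rightarrow> ennreal" where
  "cond_weight_law p F i B = cond_nn_expect p F i (\<lambda>a r. indicator B r)"

definition m_entry ::
  "(orient \<Rightarrow> orient list pmf) \<Rightarrow> (orient \<Rightarrow> orient list \<Rightarrow> real list measure)
    \<Rightarrow> orient \<Rightarrow> orient \<Rightarrow> real \<Rightarrow> ennreal" where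
  "m_entry p F i j \<theta> =
     cond_nn_expect p F i (\<lambda>a r. \<Sum>k | k < length a \<and> a ! k = j. ennreal ((r ! k) powr \<theta>))"

definition m_matrix ::
  "(orient \<Rightarrow> orient list pmf) \<Rightarrow> (orient \<Rightarrow> orient list \<Rightarrow> real list measure) \<Rightarrow> real \<Rightarrow> real mat" where
  "m_matrix p F \<theta> = mat_of_rows_list 2
     [[enn2real (m_entry p F Up Up \<theta>),   enn2real (m_entry p F Up Down \<theta>)],
      [enn2real (m_entry p F Down Up \<theta>), enn2real (m_entry p F Down Down \<theta>)]]"

text \<open>A 2-by-2 matrix with nonnegative entries has only real eigenvalues.\<close>

definition largest_eigenvalue ::
  "(orient \<Rightarrow> orient list pmf) \<Rightarrow> (orient \<Rightarrow> orient list \<Rightarrow> real list measure) \<Rightarrow> real \<Rightarrow> real" where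
  "largest_eigenvalue p F \<theta> = Max {l. eigenvalue (m_matrix p F \<theta>) l}"

definition first_up_prob :: "(orient \<Rightarrow> orient list pmf) \<Rightarrow> orient \<Rightarrow> real" where
  "first_up_prob p i = measure_pmf.prob (p i) {a. hd a = Up}"

definition root_up_prob :: "(orient \<Rightarrow> orient list pmf) \<Rightarrow> real \<Rightarrow> bool" where
  "root_up_prob p astar \<longleftrightarrow>
     (let u = first_up_prob p Up; v = first_up_prob p Down in
      if (u, v) = (1, 0) then 0 \<le> astar \<and> astar \<le> 1 else astar = v / (1 - u + v))"


section \<open>Assumptions on the distributions\<close>

text \<open>Recall that \<open>0 * ln 0 = 0\<close>, and that \<open>z * ln z \<ge> 0\<close> for natural numbers \<open>z\<close>.\<close>

definition assumption_I :: "(orient \<Rightarrow> orient list pmf) \<Rightarrow> bool" where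
  "assumption_I p \<longleftrightarrow>
     (\<forall>i. (\<integral>\<^sup>+ a. of_nat (length a) \<partial>measure_pmf (p i)) > (2 :: ennreal)) \<and>
     (\<forall>i j. (\<integral>\<^sup>+ a. ennreal (real (count_list a i) * ln (real (count_list a i)))
              \<partial>measure_pmf (p j)) < \<infinity>)"

text \<open>
  The last condition distinguishes whether the law of the weight vector depends on the orientation
  of the crossing; if it does not, the conditional expectation given either orientation is the
  unconditional one.
\<close>

definition assumption_II ::
  "(orient \<Rightarrow> orient list pmf) \<Rightarrow> (orient \<Rightarrow> orient list \<Rightarrow> real list measure) \<Rightarrow> bool" where
  "assumption_II p F \<longleftrightarrow>
     (\<forall>i. \<forall>a \<in> set_pmf (p i). AE r in F i a. \<forall>x \<in> set r. 0 < x) \<and>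
     (\<forall>\<^sub>F \<theta> in nhds 1. \<forall>i j. m_entry p F i j \<theta> < \<infinity>) \<and>
     largest_eigenvalue p F 1 = 1 \<and>
     (\<exists>D < 0. (largest_eigenvalue p F has_real_derivative D) (at 1)) \<and>
     (if \<forall>B \<in> sets (list_space borel). cond_weight_law p F Up B = cond_weight_law p F Down B
      then \<forall>i. cond_expect p F i (\<lambda>a r. sum_list r * ln (sum_list r)) < \<infinity>
      else \<exists>\<delta> > 1. largest_eigenvalue p F \<delta> < 1 \<and>
             (\<forall>i. cond_nn_expect p F i (\<lambda>a r. ennreal (sum_list r powr \<delta>)) < \<infinity>))"

definition assumption_III ::
  "(orient \<Rightarrow> orient list pmf) \<Rightarrow> (orient \<Rightarrow> orient list \<Rightarrow> real list measure) \<Rightarrow> bool" where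
  "assumption_III p F \<longleftrightarrow>
     (let u = first_up_prob p Up; v = first_up_prob p Down;
          E = (\<lambda>i. cond_expect p F i (\<lambda>a r. ln (hd r))) in
      (u \<noteq> 1 \<and> v \<noteq> 0 \<longrightarrow> ereal (1 / (1 - u)) * E Up + ereal (1 / v) * E Down < 0) \<and>
      (u = 1 \<longrightarrow> E Up < 0) \<and>
      (v = 0 \<longrightarrow> E Down < 0))"


section \<open>Marked two-type Galton--Watson trees\<close>

text \<open>
  A random marked tree is a family \<open>X\<close> indexed by Ulam--Harris addresses (children numbered from 1),
  where \<open>X \<sigma> \<omega>\<close> is \<^const>\<open>None\<close> if the tree has no node \<open>\<sigma>\<close> and \<open>Some (\<alpha>, A, R)\<close> for a node of
  type \<open>\<alpha>\<close> with offspring types \<open>A\<close> and weights \<open>R\<close> otherwise.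
\<close>

definition mark_event ::
  "'w measure \<Rightarrow> (nat list \<Rightarrow> 'w \<Rightarrow> mark option) \<Rightarrow> nat list \<Rightarrow> mark set \<Rightarrow> 'w set" where
  "mark_event M X \<sigma> B = {\<omega> \<in> space M. \<exists>x \<in> B. X \<sigma> \<omega> = Some x}"

text \<open>
  Events determined by the marks of the nodes other than \<open>\<sigma>\<close> and its descendants
  (\<^const>\<open>prefix\<close> is the nonstrict prefix order).
\<close>

definition nondescendant_events ::
  "'w measure \<Rightarrow> (nat list \<Rightarrow> 'w \<Rightarrow> mark option) \<Rightarrow> nat list \<Rightarrow> 'w set set" where
  "nondescendant_events M X \<sigma> = sigma_sets (space M)
     {mark_event M X \<tau> B |\<tau> B. \<not> prefix \<sigma> \<tau> \<and> B \<in> sets mark_space}"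

text \<open>
  The last clause: conditional on \<open>\<sigma>\<close> being a node of type \<open>i\<close>, its pair \<open>(A, R)\<close> is independent of
  all marks outside the subtree of \<open>\<sigma>\<close>, \<open>A\<close> has law \<open>p i\<close>, and \<open>R\<close> has law \<open>F i a\<close> given \<open>A = a\<close>.
\<close>

definition marked_galton_watson ::
  "(orient \<Rightarrow> orient list pmf) \<Rightarrow> (orient \<Rightarrow> orient list \<Rightarrow> real list measure) \<Rightarrow> real
    \<Rightarrow> 'w measure \<Rightarrow> (nat list \<Rightarrow> 'w \<Rightarrow> mark option) \<Rightarrow> bool" where
  "marked_galton_watson p F astar M X \<longleftrightarrow>
     (\<forall>\<sigma>. \<forall>B \<in> sets mark_space. mark_event M X \<sigma> B \<in> sets M) \<and>
     (\<forall>\<omega> \<in> space M. X [] \<omega> \<noteq> None) \<and>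
     (\<forall>\<omega> \<in> space M. \<forall>\<sigma> j. case X \<sigma> \<omega> of
        None \<Rightarrow> X (\<sigma> @ [j]) \<omega> = None
      | Some (i, A, R) \<Rightarrow>
          (if 1 \<le> j \<and> j \<le> length A
           then \<exists>A' R'. X (\<sigma> @ [j]) \<omega> = Some (A ! (j - 1), A', R')
           else X (\<sigma> @ [j]) \<omega> = None)) \<and>
     measure M (mark_event M X [] {(i, A, R). i = Up}) = astar \<and>
     (\<forall>\<sigma> i a. \<forall>E \<in> nondescendant_events M X \<sigma>. \<forall>B \<in> sets (list_space borel).
        measure M (E \<inter> mark_event M X \<sigma> {(i', A, R). i' = i \<and> A = a \<and> R \<in> B}) =
        measure M (E \<inter> mark_event M X \<sigma> {(i', A, R). i' = i}) * pmf (p i) a * measure (F i a) B)"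


section \<open>Multifractal embedded branching processes\<close>

text \<open>
  \<open>Y t\<close> is the position at time \<open>t\<close> and \<open>R n k\<close> the weight vector of the crossing \<open>k\<close> of level \<open>n\<close>.
\<close>

definition crossing_mark ::
  "(real \<Rightarrow> 'w \<Rightarrow> real) \<Rightarrow> (int \<Rightarrow> nat \<Rightarrow> 'w \<Rightarrow> real list) \<Rightarrow> 'w \<Rightarrow> int \<Rightarrow> nat \<Rightarrow> mark" where
  "crossing_mark Y R \<omega> n k =
     (crossing_orient (\<lambda>t. Y t \<omega>) n k, offspring (\<lambda>t. Y t \<omega>) n k, R n k \<omega>)"

definition first_crossing_tree ::
  "(real \<Rightarrow> 'w \<Rightarrow> real) \<Rightarrow> (int \<Rightarrow> nat \<Rightarrow> 'w \<Rightarrow> real list) \<Rightarrow> int \<Rightarrow> nat list \<Rightarrow> 'w \<Rightarrow> mark option" where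
  "first_crossing_tree Y R N \<sigma> \<omega> =
     map_option (crossing_mark Y R \<omega> (N - int (length \<sigma>))) (descendant (\<lambda>t. Y t \<omega>) N 1 \<sigma>)"

text \<open>
  That the first crossing of level \<open>N\<close> is the first child of the first crossing of level \<open>N + 1\<close>, and
  that every crossing descends from the first crossing of some level, need not be required: both are
  properties of the crossings of any continuous path started at 0. The last clause says that the
  durations of the crossings are functions of the marks (of the crossings numbered from 1); no particular
  form of \<open>\<Phi>\<close> is assumed.
\<close>

definition mebp ::
  "(orient \<Rightarrow> orient list pmf) \<Rightarrow> (orient \<Rightarrow> orient list \<Rightarrow> real list measure) \<Rightarrow> real
    \<Rightarrow> 'w measure \<Rightarrow> (real \<Rightarrow> 'w \<Rightarrow> real) \<Rightarrow> (int \<Rightarrow> nat \<Rightarrow> 'w \<Rightarrow> real list) \<Rightarrow> bool" where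
  "mebp p F astar M Y R \<longleftrightarrow>
     prob_space M \<and>
     (\<forall>t \<ge> 0. Y t \<in> borel_measurable M) \<and>
     (\<forall>n. \<forall>k \<ge> 1. R n k \<in> measurable M (list_space borel)) \<and>
     (\<forall>\<omega> \<in> space M. continuous_on {0..} (\<lambda>t. Y t \<omega>) \<and> Y 0 \<omega> = 0 \<and> crossings_exist (\<lambda>t. Y t \<omega>)) \<and>
     (\<forall>N. marked_galton_watson p F astar M (first_crossing_tree Y R N)) \<and>
     (\<exists>\<Phi>. AE \<omega> in M. \<forall>n. \<forall>k \<ge> 1.
        crossing_time (\<lambda>t. Y t \<omega>) n k - crossing_time (\<lambda>t. Y t \<omega>) n (k - 1) =
        \<Phi> (\<lambda>m j. crossing_mark Y R \<omega> m (Suc j)) n k)"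


section \<open>The process of ancestral lines\<close>

type_synonym line_entry = "nat \<times> nat \<times> nat \<times> orient list \<times> real list"

definition line_entry ::
  "(real \<Rightarrow> 'w \<Rightarrow> real) \<Rightarrow> (int \<Rightarrow> nat \<Rightarrow> 'w \<Rightarrow> real list) \<Rightarrow> nat \<Rightarrow> nat \<Rightarrow> 'w \<Rightarrow> line_entry" where
  "line_entry Y R n k \<omega> =
     (let y = (\<lambda>t. Y t \<omega>);
          \<kappa> = ancestor y 0 (int n) k;
          \<kappa>' = ancestor y 0 (int (n + 1)) k in
      (\<kappa>, position y (int n) \<kappa>, num_offspring y (int (n + 1)) \<kappa>',
       offspring y (int (n + 1)) \<kappa>', R (int (n + 1)) \<kappa>' \<omega>))"

definition line_length :: "(real \<Rightarrow> real) \<Rightarrow> nat \<Rightarrow> nat" where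
  "line_length y k = (LEAST n. ancestor y 0 (int (n + 1)) k = 1)"

definition ancestral_line ::
  "(real \<Rightarrow> 'w \<Rightarrow> real) \<Rightarrow> (int \<Rightarrow> nat \<Rightarrow> 'w \<Rightarrow> real list) \<Rightarrow> nat \<Rightarrow> 'w \<Rightarrow> line_entry list" where
  "ancestral_line Y R k \<omega> =
     map (\<lambda>n. line_entry Y R n k \<omega>) [0..<Suc (line_length (\<lambda>t. Y t \<omega>) k)]"

definition line_space :: "line_entry list measure" where
  "line_space = list_space
     (count_space UNIV \<Otimes>\<^sub>M count_space UNIV \<Otimes>\<^sub>M count_space UNIV \<Otimes>\<^sub>M count_space UNIV \<Otimes>\<^sub>M
      list_space borel)"


section \<open>Markov processes\<close>

text \<open>Discrete time, indexed by \<open>1, 2, \<dots>\<close>, with values in an arbitrary measurable space.\<close>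

definition past_algebra :: "'w measure \<Rightarrow> 's measure \<Rightarrow> (nat \<Rightarrow> 'w \<Rightarrow> 's) \<Rightarrow> nat \<Rightarrow> 'w measure" where
  "past_algebra M S X k =
     vimage_algebra (space M) (\<lambda>\<omega>. \<lambda>j \<in> {1..k}. X j \<omega>) (Pi\<^sub>M {1..k} (\<lambda>_. S))"

definition present_algebra :: "'w measure \<Rightarrow> 's measure \<Rightarrow> (nat \<Rightarrow> 'w \<Rightarrow> 's) \<Rightarrow> nat \<Rightarrow> 'w measure" where
  "present_algebra M S X k = vimage_algebra (space M) (X k) S"

definition markov_process :: "'w measure \<Rightarrow> 's measure \<Rightarrow> (nat \<Rightarrow> 'w \<Rightarrow> 's) \<Rightarrow> bool" where
  "markov_process M S X \<longleftrightarrow>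
     prob_space M \<and>
     (\<forall>k \<ge> 1. X k \<in> measurable M S) \<and>
     (\<forall>k \<ge> 1. \<forall>B \<in> sets S. AE \<omega> in M.
        real_cond_exp M (past_algebra M S X k) (indicator (X (Suc k) -` B \<inter> space M)) \<omega> =
        real_cond_exp M (present_algebra M S X k) (indicator (X (Suc k) -` B \<inter> space M)) \<omega>)"

end

(*
  The marks of the crossings of levels 1 to L inside the first crossing of level L have an explicit
  joint law: for a set of such crossings containing, with each element, its parent and everything
  of the parent's level to the left of it, the probability that the offspring vectors are prescribed
  and the weights lie in prescribed sets is a product over the set, times the law of the root type.
  On the event that these offspring vectors are prescribed, the Ulam-Harris address and the type of
  each crossing are constants, so the factors come one by one from the Galton-Watson property.

  The lines Y(1), ..., Y(k) are functions of the marks of the crossings of levels 1 to N(k)+1 that have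
  started before the end of the k-th crossing of level 0, and Y(k+1) involves in addition one fresh
  crossing on each of the levels at which the line moves. Dividing the two products leaves only the
  factors of the fresh crossings, whose types can be read off from Y(k) and Y(k+1). If Y(k) ends the
  first crossing of level N(k)+1, the root changes as well, but the type of the old root is the last
  entry of its offspring vector, which is part of Y(k). Hence the conditional law of Y(k+1) given the
  past depends on Y(k) only.
*)
theory Submission
  imports Defs
begin


section \<open>Crossing times of a path\<close>

text \<open>The obstacle is that the set of crossings making up the past is itself random. The
  combinatorics is therefore done for deterministic forests. The past read off one forest is
  recognisable from the offspring vectors on that very set (\<open>agree_past_nodes\<close>), as for
  a stopping set. Prescribing these vectors splits the probability space into countably many
  cylinders, on each of which the product formula applies. Dividing two products is only possible if
  both belong to cylinders, and the quotient may not remember the past. Both follow by splicing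
  forests: whenever a step from \<open>d\<close> to \<open>D\<close> occurs in one forest
  \<open>b\<close>, it can be grafted onto the past of any forest \<open>a\<close> whose line is
  \<open>d\<close>, and "past as in \<open>a\<close>, next line \<open>D\<close>" is again a single
  cylinder (\<open>agree_merge_Suc_iff\<close>). Weights cannot be prescribed exactly, since their
  laws are arbitrary. They only range over measurable sets, and those of crossings common to both
  lines contribute an indicator instead of a factor. All identities are proved on
  intersection-stable generators, for the past as well as for the next line.\<close>

lemma closed_subset_dyadic_grid:
  assumes "T \<subseteq> dyadic_grid n"
  shows "closed T"
proof -
  have pos: "(2::real) powi n > 0" by simp
  define Z where "Z = (\<lambda>x::real. x / 2 powi n) ` T"
  have "Z \<subseteq> \<int>"
    using assms pos by (auto simp: Z_def dyadic_grid_def)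
  then have "closed Z" by (rule closed_subset_Ints)
  moreover have "T = (\<lambda>x. 2 powi n *\<^sub>R x) ` Z"
    using pos by (force simp: Z_def image_image)
  ultimately show ?thesis using closed_scaling[of Z "2 powi n"] by simp
qed

lemma dyadic_grid_dist:
  assumes "x \<in> dyadic_grid n" "z \<in> dyadic_grid n" "x \<noteq> z"
  shows "\<bar>x - z\<bar> \<ge> 2 powi n"
proof -
  obtain i j where ij: "x = 2 powi n * of_int i" "z = 2 powi n * of_int j"
    using assms by (auto simp: dyadic_grid_def)
  then have "i \<noteq> j" using assms by auto
  then have "\<bar>i - j\<bar> \<ge> 1" by linarith
  then have "1 \<le> \<bar>real_of_int (i - j)\<bar>" by linarith
  then have "2 powi n * 1 \<le> 2 powi n * \<bar>real_of_int (i - j)\<bar>"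
    by (intro mult_left_mono) auto
  also have "\<dots> = \<bar>x - z\<bar>" by (simp add: ij abs_mult right_diff_distrib[symmetric])
  finally show ?thesis by simp
qed

lemma dyadic_grid_subset: "dyadic_grid n \<subseteq> dyadic_grid (n - 1)"
proof
  fix x assume "x \<in> dyadic_grid n"
  then obtain i where "x = 2 powi n * of_int i" by (auto simp: dyadic_grid_def)
  moreover have "(2::real) powi n = 2 powi (n - 1) * 2"
    using power_int_add_1[of "2::real" "n - 1"] by simp
  ultimately have "x = 2 powi (n - 1) * of_int (2 * i)" by simp
  then show "x \<in> dyadic_grid (n - 1)" unfolding dyadic_grid_def by blast
qed

lemma zero_in_dyadic_grid: "0 \<in> dyadic_grid n"
  unfolding dyadic_grid_def by (intro CollectI exI[of _ 0]) simp

locale crossing_path =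
  fixes y :: "real \<Rightarrow> real"
  assumes cont: "continuous_on {0..} y"
    and start: "y 0 = 0"
    and exist: "crossings_exist y"
begin

text \<open>The infimum is attained because the set of candidate times is closed. Nonnegativity of
  the starting time is a premise since continuity is known on the half-line only;
  \<open>crossing_time_nonneg\<close> then follows by induction.\<close>

lemma crossing_time_Suc:
  assumes nn: "crossing_time y n k \<ge> 0"
  defines "s \<equiv> crossing_time y n k" and "t \<equiv> crossing_time y n (Suc k)"
  shows "s < t" "y t \<in> dyadic_grid n" "y t \<noteq> y s"
    "\<And>x. s < x \<Longrightarrow> y x \<in> dyadic_grid n \<Longrightarrow> y x \<noteq> y s \<Longrightarrow> t \<le> x"
proof -
  define C where "C = {x. x > s \<and> y x \<in> dyadic_grid n \<and> y x \<noteq> y s}"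
  have t: "t = Inf C" by (simp add: t_def s_def C_def)
  \<comment> \<open>At \<open>x = s\<close> the value \<open>y s\<close> is excluded anyway, so the
    strict inequality can be relaxed; this exhibits \<open>C\<close> as a closed preimage.\<close>
  have C: "C = {x \<in> {0..} \<inter> {s..}. y x \<in> dyadic_grid n - {y s}}"
    using nn by (auto simp: C_def s_def order.order_iff_strict)
  have "closed C"
  proof -
    have "closed ({s..} \<inter> y -` (dyadic_grid n - {y s}))"
      using nn by (intro continuous_closed_preimage closed_subset_dyadic_grid[of "dyadic_grid n - {y s}" n]
          continuous_on_subset[OF cont]) (auto simp: s_def)
    moreover have "{s..} \<inter> y -` (dyadic_grid n - {y s}) = C"
      using nn by (auto simp: C s_def)
    ultimately show ?thesis by simp
  qed
  moreover have "C \<noteq> {}" using exist unfolding crossings_exist_def C_def s_def by blast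
  moreover have bdd: "bdd_below C" by (rule bdd_belowI[of _ s]) (auto simp: C_def)
  ultimately have "t \<in> C" using closed_contains_Inf[of C] t by simp
  then show "s < t" "y t \<in> dyadic_grid n" "y t \<noteq> y s" by (auto simp: C_def)
  show "t \<le> x" if "s < x" "y x \<in> dyadic_grid n" "y x \<noteq> y s" for x
    unfolding t by (rule cInf_lower[OF _ bdd]) (use that in \<open>auto simp: C_def\<close>)
qed

lemma crossing_time_nonneg: "crossing_time y n k \<ge> 0"
proof (induction k)
  case (Suc k)
  then show ?case using crossing_time_Suc(1)[OF Suc] by linarith
qed simp

lemmas crossing_time_less_Suc = crossing_time_Suc(1)[OF crossing_time_nonneg]
lemmas crossing_time_Suc_noteq = crossing_time_Suc(3)[OF crossing_time_nonneg]
lemmas crossing_time_Suc_le = crossing_time_Suc(4)[OF crossing_time_nonneg]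

lemma crossing_time_in_grid: "y (crossing_time y n k) \<in> dyadic_grid n"
  by (cases k) (use crossing_time_Suc(2)[OF crossing_time_nonneg] start zero_in_dyadic_grid
      in \<open>auto simp del: crossing_time.simps(2)\<close>)

lemma crossing_time_strict_mono: "strict_mono (crossing_time y n)"
  by (rule strict_mono_Suc_iff[THEN iffD2]) (use crossing_time_less_Suc in blast)

text \<open>Bounded crossing times would converge, and by continuity so would the path along them;
  but successive values are distinct grid points and stay \<open>2 powi n\<close> apart.\<close>

lemma crossing_time_unbounded: "\<exists>k. crossing_time y n k > x"
proof (rule ccontr)
  let ?T = "crossing_time y n"
  assume "\<not> ?thesis"
  then have "?T k \<le> x" for k by (auto simp: not_less)
  moreover have "incseq ?T" using crossing_time_strict_mono by (rule strict_mono_mono)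
  ultimately obtain l where l: "?T \<longlonglongrightarrow> l" by (metis incseq_convergent)
  have "l \<ge> 0" using crossing_time_nonneg by (intro LIMSEQ_le_const[OF l]) auto
  have "(\<lambda>k. y (?T k)) \<longlonglongrightarrow> y l"
    by (rule continuous_on_tendsto_compose[OF cont l])
       (use \<open>l \<ge> 0\<close> crossing_time_nonneg in auto)
  then have "Cauchy (\<lambda>k. y (?T k))" by (rule LIMSEQ_imp_Cauchy)
  then obtain N where N: "\<And>m k. m \<ge> N \<Longrightarrow> k \<ge> N \<Longrightarrow> dist (y (?T m)) (y (?T k)) < 2 powi n"
    unfolding Cauchy_def by (meson zero_less_power_int zero_less_numeral)
  have "dist (y (?T (Suc N))) (y (?T N)) \<ge> 2 powi n"
    unfolding dist_real_def
    by (intro dyadic_grid_dist crossing_time_in_grid crossing_time_Suc_noteq)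
  then show False using N[of "Suc N" N] by simp
qed

text \<open>Take the last fine crossing time \<open>?S j\<close> up to the coarse time
  \<open>?t\<close>. If it were earlier than \<open>?t\<close>, the path would have the same value
  at both, as no fine crossing ends in between. That value is a coarse grid point different from the
  start of the coarse crossing, so this crossing would already have ended at
  \<open>?S j\<close>.\<close>

lemma crossing_time_refine: "\<exists>j. crossing_time y (n - 1) j = crossing_time y n k"
proof (induction k)
  case 0
  show ?case by (rule exI[of _ 0]) simp
next
  case (Suc k)
  let ?S = "crossing_time y (n - 1)" and ?t = "crossing_time y n (Suc k)"
  obtain j0 where j0: "?S j0 = crossing_time y n k" using Suc by auto
  define P where "P = (\<lambda>j. ?S j \<le> ?t)"
  have "\<exists>m. \<forall>j. P j \<longrightarrow> j \<le> m"
  proof -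
    obtain m where "?S m > ?t" using crossing_time_unbounded by blast
    then have "P j \<longrightarrow> j \<le> m" for j
      using strict_mono_less[OF crossing_time_strict_mono, of "n - 1" j m]
      unfolding P_def by linarith
    then show ?thesis by blast
  qed
  moreover have "P j0" using crossing_time_less_Suc[of n k] by (simp add: P_def j0 del: crossing_time.simps(2))
  ultimately obtain j where j: "P j" and jmax: "\<And>i. P i \<Longrightarrow> i \<le> j"
    using GreatestI_nat[of P j0] Greatest_le_nat[of P] by metis
  have "j0 \<le> j" using jmax \<open>P j0\<close> by blast
  have lt: "?t < ?S (Suc j)" using jmax[of "Suc j"] by (fastforce simp: P_def simp del: crossing_time.simps(2))
  have "?S j = ?t"
  proof (rule ccontr)
    assume "?S j \<noteq> ?t"
    then have jt: "?S j < ?t" using j by (simp add: P_def del: crossing_time.simps(2))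
    have tg: "y ?t \<in> dyadic_grid n" by (rule crossing_time_in_grid)
    have eq: "y ?t = y (?S j)"
      using crossing_time_Suc_le[of "n - 1" j ?t] jt tg dyadic_grid_subset lt by force
    have ne: "y ?t \<noteq> y (?S j0)" unfolding j0 by (rule crossing_time_Suc_noteq)
    have "?S j0 < ?S j"
      using \<open>j0 \<le> j\<close> eq ne crossing_time_strict_mono[THEN strict_monoD, of j0 j "n - 1"]
      by (cases "j0 = j") (auto simp del: crossing_time.simps(2))
    then have "?t \<le> ?S j"
      using crossing_time_Suc_le[of n k "?S j"] tg eq ne by (simp add: j0 del: crossing_time.simps(2))
    then show False using jt by simp
  qed
  then show ?case by blast
qed

definition refine_index :: "int \<Rightarrow> nat \<Rightarrow> nat" where
  "refine_index n k = (SOME j. crossing_time y (n - 1) j = crossing_time y n k)"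

lemma crossing_time_refine_index: "crossing_time y (n - 1) (refine_index n k) = crossing_time y n k"
  unfolding refine_index_def using crossing_time_refine by (rule someI_ex)

lemma crossing_time_le_iff [simp]: "crossing_time y n i \<le> crossing_time y n j \<longleftrightarrow> i \<le> j"
  by (rule strict_mono_less_eq[OF crossing_time_strict_mono])

lemma crossing_time_less_iff [simp]: "crossing_time y n i < crossing_time y n j \<longleftrightarrow> i < j"
  by (rule strict_mono_less[OF crossing_time_strict_mono])

lemma crossing_time_eq_iff [simp]: "crossing_time y n i = crossing_time y n j \<longleftrightarrow> i = j"
  by (metis crossing_time_le_iff eq_iff)

lemma refine_index_0 [simp]: "refine_index n 0 = 0"
  using crossing_time_refine_index[of n 0] crossing_time_eq_iff[of "n - 1" _ 0] by simp

text \<open>A coarse crossing covers two fine grid steps. By the intermediate value theorem it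
  visits the fine grid point \<open>c\<close> adjacent to its start strictly before it ends, so a
  first child ends before the parent does.\<close>

lemma two_le_refine_index_diff: "refine_index n k + 2 \<le> refine_index n (Suc k)"
proof -
  let ?S = "crossing_time y (n - 1)" and ?s = "crossing_time y n k" and ?t = "crossing_time y n (Suc k)"
  have less: "refine_index n k < refine_index n (Suc k)"
    using crossing_time_refine_index[of n k] crossing_time_refine_index[of n "Suc k"]
      crossing_time_less_Suc[of n k] crossing_time_less_iff by metis
  moreover have "refine_index n (Suc k) \<noteq> Suc (refine_index n k)"
  proof
    assume eq: "refine_index n (Suc k) = Suc (refine_index n k)"
    let ?h = "(2::real) powi (n - 1)"
    have hh: "(2::real) powi n = 2 * ?h"
      using power_int_add_1[of "2::real" "n - 1"] by simp
    have hpos: "?h > 0" by simp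
    have st: "?s < ?t" by (rule crossing_time_less_Suc)
    have far: "\<bar>y ?t - y ?s\<bar> \<ge> 2 * ?h"
      unfolding hh[symmetric]
      by (intro dyadic_grid_dist crossing_time_in_grid crossing_time_Suc_noteq)
    have far': "y ?t > y ?s \<Longrightarrow> y ?t - y ?s \<ge> 2 * ?h" "\<not> y ?t > y ?s \<Longrightarrow> y ?s - y ?t \<ge> 2 * ?h"
      using far by linarith+
    define c where "c = (if y ?t > y ?s then y ?s + ?h else y ?s - ?h)"
    have cg: "c \<in> dyadic_grid (n - 1)"
    proof -
      obtain i where i: "y ?s = ?h * of_int i"
        using crossing_time_in_grid[of n k] dyadic_grid_subset by (force simp: dyadic_grid_def)
      then have "c = ?h * of_int (if y ?t > y ?s then i + 1 else i - 1)"
        by (simp add: c_def algebra_simps)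
      then show ?thesis unfolding dyadic_grid_def by blast
    qed
    have co: "continuous_on {?s..?t} y"
      by (rule continuous_on_subset[OF cont]) (use crossing_time_nonneg[of n k] in auto)
    have "\<exists>x. ?s \<le> x \<and> x \<le> ?t \<and> y x = c"
    proof (cases "y ?t > y ?s")
      case True
      show ?thesis by (rule IVT'[OF _ _ _ co]) (use True far st hpos in \<open>auto simp: c_def simp del: crossing_time.simps(2)\<close>)
    next
      case False
      show ?thesis by (rule IVT2'[OF _ _ _ co]) (use False far st hpos in \<open>auto simp: c_def simp del: crossing_time.simps(2)\<close>)
    qed
    then obtain x where x: "?s \<le> x" "x \<le> ?t" "y x = c" by blast
    have ne: "c \<noteq> y ?s" "c \<noteq> y ?t" using far' hpos unfolding c_def by (smt (verit))+
    have "?s < x" "x < ?t" using x ne by (auto simp: order.order_iff_strict simp del: crossing_time.simps(2))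
    then have "?S (Suc (refine_index n k)) \<le> x"
      using crossing_time_Suc_le[of "n - 1" "refine_index n k" x] x cg ne crossing_time_refine_index[of n k] by simp
    then show False using \<open>x < ?t\<close> eq crossing_time_refine_index[of n "Suc k"] by simp
  qed
  ultimately show ?thesis by simp
qed

lemma children_eq:
  assumes "1 \<le> k"
  shows "children y n k = {refine_index n (k - 1)<..refine_index n k}"
  using assms crossing_time_refine_index[of n k, symmetric] crossing_time_refine_index[of n "k - 1", symmetric]
  by (auto simp: children_def subcrossing_def simp del: crossing_time.simps(2))

lemma num_offspring_eq:
  assumes "1 \<le> k"
  shows "num_offspring y n k = refine_index n k - refine_index n (k - 1)"
  using children_eq[OF assms, of n] by (simp add: num_offspring_def offspring_def)

lemma two_le_num_offspring: "1 \<le> k \<Longrightarrow> 2 \<le> num_offspring y n k"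
  using num_offspring_eq[of k n] two_le_refine_index_diff[of n "k - 1"] by simp

lemma refine_index_eq_sum: "refine_index n k = (\<Sum>i = 1..k. num_offspring y n i)"
proof (induction k)
  case (Suc k)
  then show ?case using num_offspring_eq[of "Suc k" n] two_le_refine_index_diff[of n k] by simp
qed simp

lemma nth_children:
  assumes "1 \<le> k" "1 \<le> j" "j \<le> num_offspring y n k"
  shows "sorted_list_of_set (children y n k) ! (j - 1) = refine_index n (k - 1) + j"
proof -
  have "{refine_index n (k - 1)<..refine_index n k} = {Suc (refine_index n (k - 1))..<Suc (refine_index n k)}"
    by auto
  then show ?thesis
    using assms num_offspring_eq[of k n]
    by (simp add: children_eq sorted_list_of_set_range del: upt_Suc)
qed

end

section \<open>Ancestral lines in a forest of offspring lists\<close>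

text \<open>
  The offspring vector of the \<open>i\<close>-th crossing of level \<open>n\<close> is \<open>a n i\<close>, for \<open>n, i \<ge> 1\<close>; the crossings
  of level \<open>n - 1\<close> are numbered consecutively through these vectors.
\<close>

type_synonym forest = "nat \<Rightarrow> nat \<Rightarrow> orient list"

text \<open>Two children per crossing suffice for the combinatorics: they make \<open>parent\<close>
  lower every index from 2 on, so that each line reaches index 1.\<close>

definition branching :: "forest \<Rightarrow> bool" where
  "branching a \<longleftrightarrow> (\<forall>n. \<forall>i\<ge>1. 2 \<le> length (a n i))"

definition child_offset :: "forest \<Rightarrow> nat \<Rightarrow> nat \<Rightarrow> nat" where
  "child_offset a n q = (\<Sum>i = 1..q. length (a n i))"

text \<open>The level argument is that of the parent, whereas in \<open>sibling_pos\<close> and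
  \<open>node_type\<close> it is that of the child.\<close>

definition parent :: "forest \<Rightarrow> nat \<Rightarrow> nat \<Rightarrow> nat" where
  "parent a n i = (LEAST q. i \<le> child_offset a n q)"

definition sibling_pos :: "forest \<Rightarrow> nat \<Rightarrow> nat \<Rightarrow> nat" where
  "sibling_pos a n i = i - child_offset a (Suc n) (parent a (Suc n) i - 1)"

primrec line :: "forest \<Rightarrow> nat \<Rightarrow> nat \<Rightarrow> nat" where
  "line a 0 k = k"
| "line a (Suc n) k = parent a (Suc n) (line a n k)"

definition top_level :: "forest \<Rightarrow> nat \<Rightarrow> nat" where
  "top_level a k = (LEAST n. line a (Suc n) k = 1)"

text \<open>
  The crossings of levels \<open>1, \<dots>, N(k) + 1\<close> that have started before the end of the \<open>k\<close>-th crossing of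
  level 0.
\<close>

definition past_nodes :: "forest \<Rightarrow> nat \<Rightarrow> (nat \<times> nat) set" where
  "past_nodes a k = {(n, i). 1 \<le> n \<and> n \<le> Suc (top_level a k) \<and> 1 \<le> i \<and> i \<le> line a n k}"

text \<open>The set of compared nodes is read off \<open>a\<close> alone;
  \<open>agree_past_nodes\<close> shows that it is then the past of \<open>b\<close> as
  well.\<close>

definition agree :: "forest \<Rightarrow> nat \<Rightarrow> forest \<Rightarrow> bool" where
  "agree a k b \<longleftrightarrow> (\<forall>(n, i) \<in> past_nodes a k. b n i = a n i)"

definition node_type :: "forest \<Rightarrow> nat \<Rightarrow> nat \<Rightarrow> orient" where
  "node_type a n i = a (Suc n) (parent a (Suc n) i) ! (sibling_pos a n i - 1)"

lemma child_offset_0 [simp]: "child_offset a n 0 = 0"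
  by (simp add: child_offset_def)

lemma child_offset_Suc: "child_offset a n (Suc q) = child_offset a n q + length (a n (Suc q))"
  by (simp add: child_offset_def)

lemma child_offset_mono: "q \<le> r \<Longrightarrow> child_offset a n q \<le> child_offset a n r"
  unfolding child_offset_def by (intro sum_mono2) auto

lemma child_offset_cong:
  "(\<And>j. 1 \<le> j \<Longrightarrow> j \<le> q \<Longrightarrow> a n j = b n j) \<Longrightarrow> child_offset a n q = child_offset b n q"
  unfolding child_offset_def by (intro sum.cong) auto

context
  fixes a :: forest
  assumes a: "branching a"
begin

lemma child_offset_ge: "2 * q \<le> child_offset a n q"
proof (induction q)
  case (Suc q)
  have "2 \<le> length (a n (Suc q))" using a by (auto simp: branching_def)
  then show ?case using Suc by (simp add: child_offset_Suc)
qed simp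

text \<open>A Galois connection, from which the bounds, uniqueness and monotonicity of the parent
  are read off. The least index exists because offsets grow at least linearly.\<close>

lemma parent_le_iff: "parent a n i \<le> q \<longleftrightarrow> i \<le> child_offset a n q"
proof
  have "i \<le> child_offset a n i" using child_offset_ge[of i n] by simp
  then have "i \<le> child_offset a n (parent a n i)" unfolding parent_def by (rule LeastI)
  then show "i \<le> child_offset a n q" if "parent a n i \<le> q"
    using child_offset_mono[OF that] order.trans by blast
  show "parent a n i \<le> q" if "i \<le> child_offset a n q"
    using that unfolding parent_def by (rule Least_le)
qed

lemma parent_bounds:
  assumes "1 \<le> i"
  shows "1 \<le> parent a n i" "child_offset a n (parent a n i - 1) < i" "i \<le> child_offset a n (parent a n i)"
    "parent a n i \<le> i"
proof -
  show 1: "1 \<le> parent a n i"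
    using parent_le_iff[of n i 0] assms by auto
  show "child_offset a n (parent a n i - 1) < i"
    using parent_le_iff[of n i "parent a n i - 1"] 1 by auto
  show "i \<le> child_offset a n (parent a n i)"
    using parent_le_iff[of n i "parent a n i"] by auto
  show "parent a n i \<le> i"
    unfolding parent_le_iff using child_offset_ge[of i n] by simp
qed

lemma parent_eqI:
  assumes "1 \<le> q" "child_offset a n (q - 1) < i" "i \<le> child_offset a n q"
  shows "parent a n i = q"
  using parent_le_iff[of n i q] parent_le_iff[of n i "q - 1"] assms by auto

lemma parent_mono: "i \<le> j \<Longrightarrow> parent a n i \<le> parent a n j"
  unfolding parent_le_iff using parent_le_iff[of n j "parent a n j"] by auto

lemma parent_1 [simp]: "parent a n (Suc 0) = Suc 0"
  using parent_bounds[of 1 n] by simp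

lemma parent_2 [simp]: "parent a n (Suc (Suc 0)) = Suc 0"
  using parent_bounds(1)[of 2 n] parent_le_iff[of n 2 1] child_offset_ge[of 1 n] by (simp add: numeral_2_eq_2)

lemma parent_less: "2 \<le> i \<Longrightarrow> parent a n i < i"
  using parent_le_iff[of n i "i - 1"] child_offset_ge[of "i - 1" n] by linarith

lemma sibling_pos_bounds:
  assumes "1 \<le> i"
  shows "1 \<le> sibling_pos a n i" "sibling_pos a n i \<le> length (a (Suc n) (parent a (Suc n) i))"
    "child_offset a (Suc n) (parent a (Suc n) i - 1) + sibling_pos a n i = i"
  using parent_bounds[OF assms, of "Suc n"] child_offset_Suc[of a "Suc n" "parent a (Suc n) i - 1"]
  by (auto simp: sibling_pos_def)

lemma parent_Suc_same:
  assumes "1 \<le> i" "sibling_pos a n i < length (a (Suc n) (parent a (Suc n) i))"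
  shows "parent a (Suc n) (Suc i) = parent a (Suc n) i" "sibling_pos a n (Suc i) = Suc (sibling_pos a n i)"
proof -
  show "parent a (Suc n) (Suc i) = parent a (Suc n) i"
    using assms(2) sibling_pos_bounds[OF assms(1), of n] parent_bounds[OF assms(1), of "Suc n"]
      child_offset_Suc[of a "Suc n" "parent a (Suc n) i - 1"]
    by (intro parent_eqI) auto
  then show "sibling_pos a n (Suc i) = Suc (sibling_pos a n i)"
    using parent_bounds[OF assms(1), of "Suc n"] by (simp add: sibling_pos_def)
qed

lemma parent_Suc_next:
  assumes "1 \<le> i" "\<not> sibling_pos a n i < length (a (Suc n) (parent a (Suc n) i))"
  shows "parent a (Suc n) (Suc i) = Suc (parent a (Suc n) i)" "sibling_pos a n (Suc i) = 1"
proof -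
  have i: "i = child_offset a (Suc n) (parent a (Suc n) i)"
    using assms(2) sibling_pos_bounds[OF assms(1), of n] parent_bounds[OF assms(1), of "Suc n"]
      child_offset_Suc[of a "Suc n" "parent a (Suc n) i - 1"] by auto
  have "2 \<le> length (a (Suc n) (Suc (parent a (Suc n) i)))" using a by (auto simp: branching_def)
  then show 1: "parent a (Suc n) (Suc i) = Suc (parent a (Suc n) i)"
    using i by (intro parent_eqI) (auto simp: child_offset_Suc)
  show "sibling_pos a n (Suc i) = 1"
    unfolding sibling_pos_def 1 using i by simp
qed

lemma parent_Suc_cases: "1 \<le> i \<Longrightarrow> parent a (Suc n) (Suc i) = parent a (Suc n) i \<or>
    parent a (Suc n) (Suc i) = Suc (parent a (Suc n) i)"
  using parent_Suc_same parent_Suc_next by blast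

lemma line_mono: "j \<le> k \<Longrightarrow> line a n j \<le> line a n k"
  by (induction n) (auto intro: parent_mono)

lemma line_pos: "1 \<le> k \<Longrightarrow> 1 \<le> line a n k"
  by (induction n) (simp_all add: parent_bounds(1)[unfolded One_nat_def])

text \<open>Each level lowers an index above 1 by at least one. This guarantees that the minimum in
  \<open>top_level\<close> exists.\<close>

lemma line_bound: "1 \<le> k \<Longrightarrow> line a n k \<le> max 1 (k - n)"
proof (induction n)
  case (Suc n)
  then have IH: "line a n k \<le> max 1 (k - n)" by simp
  show ?case
  proof (cases "line a n k \<ge> 2")
    case True
    then show ?thesis using parent_less[OF True, of "Suc n"] IH by simp
  next
    case False
    then have "line a n k = Suc 0" using line_pos[OF Suc.prems, of n] by simp
    then show ?thesis by simp
  qed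
qed simp

lemma line_top:
  assumes "1 \<le> k"
  shows "line a (Suc (top_level a k)) k = 1"
proof -
  have "line a (Suc k) k = 1" using line_bound[OF assms, of "Suc k"] line_pos[OF assms, of "Suc k"] by simp
  then show ?thesis unfolding top_level_def by (rule LeastI)
qed

lemma line_above_top:
  assumes "1 \<le> k" "top_level a k < n"
  shows "line a n k = 1"
  using assms(2)
proof (induction n)
  case (Suc n)
  then show ?case using line_top[OF assms(1)]
    by (cases "top_level a k = n") auto
qed simp

lemma line_below_top:
  assumes "1 \<le> k" "1 \<le> n" "n \<le> top_level a k"
  shows "2 \<le> line a n k"
proof -
  have "line a (Suc (n - 1)) k \<noteq> 1"
    using assms(2,3) not_less_Least[of "n - 1" "\<lambda>n. line a (Suc n) k = 1"] by (simp add: top_level_def)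
  then show ?thesis using line_pos[OF assms(1), of n] assms(2) by auto
qed

lemma top_level_mono:
  assumes "1 \<le> j" "j \<le> k"
  shows "top_level a j \<le> top_level a k"
proof -
  have "line a (Suc (top_level a k)) j = 1"
    using line_top[of k] line_mono[OF assms(2), of "Suc (top_level a k)"] line_pos[OF assms(1), of "Suc (top_level a k)"] assms
    by simp
  then show ?thesis unfolding top_level_def[of a j] by (rule Least_le)
qed

text \<open>The right neighbour of a crossing has the same parent or the next one, and this
  propagates upwards. Hence at most one crossing per level is new when the line moves.\<close>

lemma line_Suc_cases: "1 \<le> k \<Longrightarrow> line a n (Suc k) = line a n k \<or> line a n (Suc k) = Suc (line a n k)"
proof (induction n)
  case (Suc n)
  then show ?case using parent_Suc_cases[OF line_pos[OF Suc.prems, of n], of n] by auto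
qed simp

text \<open>Where line \<open>k\<close> has index 1, line \<open>k + 1\<close> has index 1 or 2, and
  both are children of the first crossing one level up.\<close>

lemma top_level_Suc_le:
  assumes "1 \<le> k"
  shows "top_level a (Suc k) \<le> Suc (top_level a k)"
proof -
  have "line a (Suc (top_level a k)) (Suc k) \<in> {Suc 0, Suc (Suc 0)}"
    using line_Suc_cases[OF assms, of "Suc (top_level a k)"] line_top[OF assms] by auto
  then have "line a (Suc (Suc (top_level a k))) (Suc k) = 1" by auto
  then show ?thesis unfolding top_level_def[of a "Suc k"] by (rule Least_le)
qed

lemma finite_past_nodes: "finite (past_nodes a k)"
  by (rule finite_subset[of _ "SIGMA n : {..Suc (top_level a k)}. {..line a n k}"]) (auto simp: past_nodes_def)

lemma past_nodes_mono: "1 \<le> j \<Longrightarrow> j \<le> k \<Longrightarrow> past_nodes a j \<subseteq> past_nodes a k"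
  using top_level_mono[of j k] line_mono[of j k] unfolding past_nodes_def
  by clarify (meson order.trans Suc_le_mono)

lemma past_nodes_parent:
  assumes "(n, i) \<in> past_nodes a k" "n \<le> top_level a k" "1 \<le> q" "q \<le> parent a (Suc n) i"
  shows "(Suc n, q) \<in> past_nodes a k"
proof -
  have "parent a (Suc n) i \<le> line a (Suc n) k"
    using parent_mono[of i "line a n k" "Suc n"] assms by (auto simp: past_nodes_def)
  then show ?thesis using assms by (auto simp: past_nodes_def)
qed

end

section \<open>Lines and types depend on the past of the forest only\<close>

text \<open>The two offsets that characterise the parent involve no vector to the right of the
  parent's own.\<close>

lemma parent_cong:
  assumes a: "branching a" and b: "branching b"
    and eq: "\<And>q. 1 \<le> q \<Longrightarrow> q \<le> parent a n i \<Longrightarrow> b n q = a n q" and "1 \<le> i"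
  shows "parent b n i = parent a n i"
proof (rule parent_eqI[OF b])
  note bd = parent_bounds[OF a \<open>1 \<le> i\<close>, of n]
  show "1 \<le> parent a n i" by (rule bd)
  have "child_offset b n (parent a n i - 1) = child_offset a n (parent a n i - 1)"
    by (intro child_offset_cong eq) auto
  then show "child_offset b n (parent a n i - 1) < i" using bd by simp
  have "child_offset b n (parent a n i) = child_offset a n (parent a n i)"
    by (intro child_offset_cong eq) auto
  then show "i \<le> child_offset b n (parent a n i)" using bd by simp
qed

lemma sibling_pos_cong:
  assumes a: "branching a" and b: "branching b"
    and eq: "\<And>q. 1 \<le> q \<Longrightarrow> q \<le> parent a (Suc n) i \<Longrightarrow> b (Suc n) q = a (Suc n) q" and "1 \<le> i"
  shows "sibling_pos b n i = sibling_pos a n i"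
proof -
  have "child_offset b (Suc n) (parent a (Suc n) i - 1) = child_offset a (Suc n) (parent a (Suc n) i - 1)"
    by (intro child_offset_cong eq) auto
  then show ?thesis using parent_cong[OF assms] by (simp add: sibling_pos_def)
qed

lemma node_type_cong:
  assumes a: "branching a" and b: "branching b"
    and eq: "\<And>q. 1 \<le> q \<Longrightarrow> q \<le> parent a (Suc n) i \<Longrightarrow> b (Suc n) q = a (Suc n) q" and "1 \<le> i"
  shows "node_type b n i = node_type a n i"
  using parent_cong[OF assms] sibling_pos_cong[OF assms] eq parent_bounds(1)[OF a \<open>1 \<le> i\<close>]
  by (simp add: node_type_def)

context
  fixes a b :: forest and k :: nat
  assumes a: "branching a" and b: "branching b" and ag: "agree a k b" and k: "1 \<le> k"
begin

lemma agreeD: "(n, i) \<in> past_nodes a k \<Longrightarrow> b n i = a n i"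
  using ag by (auto simp: agree_def)

lemma agree_at_parent:
  assumes "n \<le> top_level a k" "1 \<le> i" "i \<le> line a n k" "1 \<le> q" "q \<le> parent a (Suc n) i"
  shows "b (Suc n) q = a (Suc n) q"
proof (rule agreeD)
  have "parent a (Suc n) i \<le> line a (Suc n) k" using parent_mono[OF a assms(3), of "Suc n"] by simp
  then show "(Suc n, q) \<in> past_nodes a k" using assms by (auto simp: past_nodes_def)
qed

text \<open>The levels are restricted to those covered by the past. That both lines have index 1
  further up is known only once the top levels are shown to coincide.\<close>

lemma agree_line:
  assumes "1 \<le> j" "j \<le> k" "n \<le> Suc (top_level a k)"
  shows "line b n j = line a n j"
  using assms(3)
proof (induction n)
  case (Suc n)
  then have IH: "line b n j = line a n j" by simp
  have "parent b (Suc n) (line a n j) = parent a (Suc n) (line a n j)"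
    using Suc.prems line_pos[OF a assms(1), of n] line_mono[OF a assms(2), of n]
    by (intro parent_cong a b agree_at_parent[of n "line a n j"]) auto
  then show ?case using IH by simp
qed simp

lemma agree_top_level:
  assumes "1 \<le> j" "j \<le> k"
  shows "top_level b j = top_level a j"
proof -
  have le: "top_level a j \<le> top_level a k" using top_level_mono[OF a assms] .
  show ?thesis unfolding top_level_def[of b j]
  proof (rule Least_equality)
    show "line b (Suc (top_level a j)) j = 1"
      using agree_line[OF assms, of "Suc (top_level a j)"] line_top[OF a assms(1)] le by simp
    show "top_level a j \<le> m" if "line b (Suc m) j = 1" for m
    proof (rule ccontr)
      assume "\<not> top_level a j \<le> m"
      then have "2 \<le> line a (Suc m) j" "line b (Suc m) j = line a (Suc m) j"
        using line_below_top[OF a assms(1), of "Suc m"] agree_line[OF assms, of "Suc m"] le by auto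
      then show False using that by simp
    qed
  qed
qed

text \<open>The stopping-set property: whether a forest has this past can be decided by looking at
  the nodes of the past themselves.\<close>

lemma agree_past_nodes: "1 \<le> j \<Longrightarrow> j \<le> k \<Longrightarrow> past_nodes b j = past_nodes a j"
  using top_level_mono[OF a, of j k] by (auto simp: past_nodes_def agree_top_level agree_line)

lemma agree_sibling_pos:
  assumes "n \<le> top_level a k" "1 \<le> i" "i \<le> line a n k"
  shows "sibling_pos b n i = sibling_pos a n i"
  using assms by (intro sibling_pos_cong a b agree_at_parent[of n i]) auto

lemma agree_node_type:
  assumes "n \<le> top_level a k" "1 \<le> i" "i \<le> line a n k"
  shows "node_type b n i = node_type a n i"
  using assms by (intro node_type_cong a b agree_at_parent[of n i]) auto

end

section \<open>The discrete part of an ancestral line and its transitions\<close>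

type_synonym discrete_entry = "nat \<times> nat \<times> nat \<times> orient list"

text \<open>Only the weights are left out; what remains takes countably many values and can be
  prescribed exactly.\<close>

definition discrete_line :: "forest \<Rightarrow> nat \<Rightarrow> discrete_entry list" where
  "discrete_line a k = map (\<lambda>n. (line a n k, sibling_pos a n (line a n k),
       length (a (Suc n) (line a (Suc n) k)), a (Suc n) (line a (Suc n) k))) [0..<Suc (top_level a k)]"

text \<open>The default 1 is the true index: from level \<open>length D\<close> on, which is not
  stored, the line runs through first crossings.\<close>

definition entry_index :: "discrete_entry list \<Rightarrow> nat \<Rightarrow> nat" where
  "entry_index D n = (if n < length D then fst (D ! n) else 1)"

definition entry_pos :: "discrete_entry list \<Rightarrow> nat \<Rightarrow> nat" where
  "entry_pos D n = fst (snd (D ! n))"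

definition entry_children :: "discrete_entry list \<Rightarrow> nat \<Rightarrow> orient list" where
  "entry_children D n = snd (snd (snd (D ! (n - 1))))"

text \<open>
  If \<open>d\<close> and \<open>D\<close> are the lines of \<open>k\<close> and \<open>k + 1\<close>, these are the levels \<open>n\<close> at which the crossing on
  the line \<open>D\<close> is not in \<open>past_nodes a k\<close>. Entry \<open>n\<close> of a line carries the children of level \<open>n + 1\<close>, which
  explains the shift in \<open>entry_children\<close>.
\<close>

definition fresh_levels :: "discrete_entry list \<Rightarrow> discrete_entry list \<Rightarrow> nat set" where
  "fresh_levels d D = {n. 1 \<le> n \<and> n \<le> length D \<and> (length d < n \<or> entry_index D n \<noteq> entry_index d n)}"

lemma length_discrete_line [simp]: "length (discrete_line a k) = Suc (top_level a k)"
  by (simp add: discrete_line_def)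

lemma entry_pos_discrete_line:
  "n \<le> top_level a k \<Longrightarrow> entry_pos (discrete_line a k) n = sibling_pos a n (line a n k)"
  by (simp add: entry_pos_def discrete_line_def del: upt_Suc)

lemma entry_children_discrete_line:
  "1 \<le> n \<Longrightarrow> n \<le> Suc (top_level a k) \<Longrightarrow> entry_children (discrete_line a k) n = a n (line a n k)"
  by (cases n) (auto simp add: entry_children_def discrete_line_def simp del: upt_Suc)

lemma entry_index_discrete_line:
  "branching a \<Longrightarrow> 1 \<le> k \<Longrightarrow> entry_index (discrete_line a k) n = line a n k"
  using line_above_top[of a k n]
  by (auto simp add: entry_index_def discrete_line_def simp del: upt_Suc)

lemma discrete_line_eqI:
  assumes "branching a" "branching b" "1 \<le> k" "1 \<le> j"
    and "\<And>n. line a n k = line b n j"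
    and "\<And>n. n \<le> top_level b j \<Longrightarrow> sibling_pos a n (line b n j) = sibling_pos b n (line b n j)"
    and "\<And>n. n \<le> top_level b j \<Longrightarrow> a (Suc n) (line b (Suc n) j) = b (Suc n) (line b (Suc n) j)"
  shows "discrete_line a k = discrete_line b j"
proof -
  have "top_level a k = top_level b j" unfolding top_level_def assms(5) ..
  then show ?thesis unfolding discrete_line_def assms(5) using assms(6,7)
    by (intro map_cong) auto
qed

lemma agree_discrete_line:
  assumes "branching a" "branching b" "agree a k b" "1 \<le> j" "j \<le> k"
  shows "discrete_line b j = discrete_line a j"
proof (rule discrete_line_eqI)
  have "1 \<le> k" using assms by simp
  note ag = assms(1-3) this
  have le: "top_level a j \<le> top_level a k" using top_level_mono[OF assms(1,4,5)] .
  show line: "line b n j = line a n j" for n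
  proof (cases "n \<le> Suc (top_level a j)")
    case True
    then show ?thesis using agree_line[OF ag assms(4,5), of n] le by simp
  next
    case False
    then show ?thesis
      using line_above_top[OF assms(1,4), of n] line_above_top[OF assms(2,4), of n] agree_top_level[OF ag assms(4,5)] by simp
  qed
  show "sibling_pos b n (line a n j) = sibling_pos a n (line a n j)" if "n \<le> top_level a j" for n
    using that le line_pos[OF assms(1,4), of n] line_mono[OF assms(1,5), of n]
    by (intro agree_sibling_pos[OF ag]) auto
  show "b (Suc n) (line a (Suc n) j) = a (Suc n) (line a (Suc n) j)" if "n \<le> top_level a j" for n
    using that le line_pos[OF assms(1,4), of "Suc n"] line_mono[OF assms(1,5), of "Suc n"]
    by (intro agreeD[OF ag]) (auto simp: past_nodes_def)
qed (use assms in auto)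

text \<open>
  Any step from \<open>d\<close> to \<open>D\<close> that occurs in some forest \<open>b\<close> is compatible with every past that ends in
  \<open>d\<close>: the merged forest has the past of \<open>a\<close> and the next line of \<open>b\<close>.
\<close>

definition merge :: "forest \<Rightarrow> forest \<Rightarrow> nat \<Rightarrow> forest" where
  "merge a b k n i = (if (n, i) \<in> past_nodes a k then a n i else b n i)"

text \<open>A level moves only if the level below has moved past the last sibling. Positions and
  numbers of siblings are stored in line \<open>k\<close>, so going up from level 0 the indices of
  the next line are computed from the current line alone.\<close>

lemma line_Suc_step:
  assumes a: "branching a" and k: "1 \<le> k" and n: "n \<le> top_level a k"
  shows "line a (Suc n) (Suc k) =
      (if line a n (Suc k) = line a n k then line a (Suc n) k
       else if sibling_pos a n (line a n k) < length (a (Suc n) (line a (Suc n) k)) then line a (Suc n) k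
       else Suc (line a (Suc n) k))"
    "sibling_pos a n (line a n (Suc k)) =
      (if line a n (Suc k) = line a n k then sibling_pos a n (line a n k)
       else if sibling_pos a n (line a n k) < length (a (Suc n) (line a (Suc n) k)) then Suc (sibling_pos a n (line a n k))
       else 1)"
  using line_Suc_cases[OF a k, of n] parent_Suc_same[OF a line_pos[OF a k], of n n]
    parent_Suc_next[OF a line_pos[OF a k], of n n] by auto

lemma line_Suc_step_above:
  assumes a: "branching a" and k: "1 \<le> k" and n: "top_level a k < n"
  shows "line a (Suc n) (Suc k) = 1"
    "sibling_pos a n (line a n (Suc k)) = line a n (Suc k)"
  using line_Suc_cases[OF a k, of n] line_above_top[OF a k n] a by (auto simp: sibling_pos_def)

context
  fixes a b :: forest and k :: nat
  assumes a: "branching a" and b: "branching b" and k: "1 \<le> k"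
    and eq: "discrete_line a k = discrete_line b k"
begin

lemma branching_merge: "branching (merge a b k)"
  using a b by (auto simp: branching_def merge_def)

lemma agree_merge: "agree a k (merge a b k)"
  by (auto simp: agree_def merge_def)

lemma top_level_eq: "top_level a k = top_level b k"
  using arg_cong[OF eq, of length] by simp

lemma line_eq: "line a n k = line b n k"
  using entry_index_discrete_line[OF a k, of n] entry_index_discrete_line[OF b k, of n] eq by simp

lemma discrete_line_merge: "discrete_line (merge a b k) k = discrete_line a k"
  using agree_discrete_line[OF a branching_merge agree_merge k] by simp

text \<open>By induction on the level the merged forest follows \<open>b\<close>: the step rules use
  only data of line \<open>k\<close>, which \<open>a\<close> and \<open>b\<close> share, and above
  the old top both lines sit among the first two children.\<close>

lemma merge_Suc:
  "line (merge a b k) n (Suc k) = line b n (Suc k) \<and>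
   (1 \<le> n \<longrightarrow> merge a b k n (line b n (Suc k)) = b n (line b n (Suc k))) \<and>
   sibling_pos (merge a b k) n (line b n (Suc k)) = sibling_pos b n (line b n (Suc k))"
proof -
  let ?c = "merge a b k"
  note c = branching_merge
  have tc: "top_level ?c k = top_level b k"
    using arg_cong[OF discrete_line_merge, of length] top_level_eq by simp
  have lc: "line ?c n k = line b n k" for n
    using entry_index_discrete_line[OF a k, of n] entry_index_discrete_line[OF c k, of n] discrete_line_merge line_eq by simp
  have ch: "?c n (line b n k) = b n (line b n k)" "a n (line b n k) = b n (line b n k)"
    if "1 \<le> n" "n \<le> Suc (top_level b k)" for n
    using entry_children_discrete_line[OF that(1), of a k] entry_children_discrete_line[OF that(1), of b k]
       entry_children_discrete_line[OF that(1), of ?c k] that discrete_line_merge eq top_level_eq lc line_eq tc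
    by auto
  have sp: "sibling_pos ?c n (line b n k) = sibling_pos b n (line b n k)" if "n \<le> top_level b k" for n
    using entry_pos_discrete_line[of n ?c k] entry_pos_discrete_line[of n b k] that discrete_line_merge eq tc lc by simp
  have step: "line ?c (Suc n) (Suc k) = line b (Suc n) (Suc k)
     \<and> sibling_pos ?c n (line ?c n (Suc k)) = sibling_pos b n (line b n (Suc k))"
    if "line ?c n (Suc k) = line b n (Suc k)" for n
  proof (cases "n \<le> top_level b k")
    case True
    then have n: "n \<le> top_level ?c k" using tc by simp
    show ?thesis
      using line_Suc_step[OF b k True] line_Suc_step[OF c k n] lc[of n] lc[of "Suc n"] that
        ch[of "Suc n"] sp[of n] True by (simp del: line.simps)
  next
    case False
    then have n: "top_level b k < n" "top_level ?c k < n" using tc by simp_all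
    show ?thesis
      using line_Suc_step_above[OF b k n(1)] line_Suc_step_above[OF c k n(2)] that by simp
  qed
  have line: "line ?c n (Suc k) = line b n (Suc k)" for n
    by (induction n) (use step in auto)
  moreover have "?c n (line b n (Suc k)) = b n (line b n (Suc k))" if "1 \<le> n"
  proof (cases "(n, line b n (Suc k)) \<in> past_nodes a k")
    \<comment> \<open>Indices never decrease, so a past node on line \<open>k + 1\<close> already
      lies on line \<open>k\<close>, where the vectors of \<open>a\<close> and \<open>b\<close>
      coincide. Any other node takes its vector from \<open>b\<close> by definition.\<close>
    case True
    then have "line b n (Suc k) = line b n k" "n \<le> Suc (top_level b k)"
      using line_Suc_cases[OF b k, of n] line_eq[of n] top_level_eq by (auto simp: past_nodes_def)
    then show ?thesis using ch[of n] that by simp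
  qed (simp add: merge_def)
  ultimately show ?thesis using step[OF line, of n] by simp
qed

lemma discrete_line_merge_Suc: "discrete_line (merge a b k) (Suc k) = discrete_line b (Suc k)"
  by (rule discrete_line_eqI) (use merge_Suc branching_merge b in \<open>auto simp del: line.simps\<close>)

text \<open>A level that was present gains at most the crossing next to the old line; a newly added
  level contributes only its first crossing, which lies on the new line.\<close>

lemma past_nodes_Suc:
  "past_nodes a (Suc k) = past_nodes a k \<union>
     (\<lambda>n. (n, line a n (Suc k))) ` fresh_levels (discrete_line a k) (discrete_line a (Suc k))" (is "?L = ?A \<union> ?B")
  and past_nodes_fresh_disjoint:
  "past_nodes a k \<inter> (\<lambda>n. (n, line a n (Suc k))) ` fresh_levels (discrete_line a k) (discrete_line a (Suc k)) = {}"
proof -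
  have le: "top_level a k \<le> top_level a (Suc k)" using top_level_mono[OF a k, of "Suc k"] by simp
  have fresh: "fresh_levels (discrete_line a k) (discrete_line a (Suc k)) =
     {n. 1 \<le> n \<and> n \<le> Suc (top_level a (Suc k)) \<and> (Suc (top_level a k) < n \<or> line a n (Suc k) \<noteq> line a n k)}"
    using k by (auto simp: fresh_levels_def entry_index_discrete_line[OF a])
  have cases: "line a n (Suc k) = line a n k \<or> line a n (Suc k) = Suc (line a n k)" for n
    using line_Suc_cases[OF a k] .
  have one: "line a n k = 1" if "top_level a k < n" for n using line_above_top[OF a k that] .
  have one': "line a n (Suc k) = 1" if "Suc (top_level a k) < n" for n
    using line_above_top[OF a, of "Suc k" n] top_level_Suc_le[OF a k] that by simp
  have pos: "1 \<le> line a n (Suc k)" for n using line_pos[OF a, of "Suc k" n] by simp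
  show "?A \<inter> ?B = {}"
    unfolding fresh using cases by (force simp: past_nodes_def)
  have "?L \<subseteq> ?A \<union> ?B"
  proof
    fix z assume "z \<in> ?L"
    then obtain n i where z: "z = (n, i)" and h: "1 \<le> n" "n \<le> Suc (top_level a (Suc k))" "1 \<le> i" "i \<le> line a n (Suc k)"
      by (auto simp: past_nodes_def)
    show "z \<in> ?A \<union> ?B"
    proof (cases "n \<le> Suc (top_level a k) \<and> i \<le> line a n k")
      case True
      then show ?thesis using h by (auto simp: z past_nodes_def)
    next
      case False
      then have "i = line a n (Suc k)"
        using h cases[of n] one'[of n] by auto
      moreover have "n \<in> fresh_levels (discrete_line a k) (discrete_line a (Suc k))"
        unfolding fresh using False h by auto
      ultimately show ?thesis by (auto simp: z)
    qed
  qed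
  moreover have "?A \<subseteq> ?L" using past_nodes_mono[OF a k, of "Suc k"] by simp
  moreover have "?B \<subseteq> ?L" unfolding fresh using pos by (auto simp: past_nodes_def)
  ultimately show "?L = ?A \<union> ?B" by blast
qed

end

lemma agree_mono:
  assumes "branching a" "agree a k b" "1 \<le> j" "j \<le> k"
  shows "agree a j b"
  using assms past_nodes_mono[OF assms(1,3,4)] by (auto simp: agree_def)

text \<open>The new nodes of the merged past all lie on line \<open>k + 1\<close>, so their vectors
  are entries of that line. This turns the joint event of a past and a next line into the event of
  one longer past.\<close>

lemma agree_merge_Suc_iff:
  assumes a: "branching a" and b: "branching b" and k: "1 \<le> k"
    and eq: "discrete_line a k = discrete_line b k" and x: "branching x"
  shows "agree (merge a b k) (Suc k) x \<longleftrightarrow> agree a k x \<and> discrete_line x (Suc k) = discrete_line b (Suc k)"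
    (is "agree ?c _ _ \<longleftrightarrow> _")
proof
  note c = branching_merge[OF a b k eq]
  note ac = agree_merge[OF a b k eq]
  have pc: "past_nodes ?c k = past_nodes a k" using agree_past_nodes[OF a c ac k] k by simp
  {
    assume h: "agree ?c (Suc k) x"
    have "agree ?c k x" using agree_mono[OF c h k] by simp
    then have "agree a k x" using ac by (fastforce simp: agree_def pc)
    moreover have "discrete_line x (Suc k) = discrete_line ?c (Suc k)"
      using agree_discrete_line[OF c x h] by simp
    ultimately show "agree a k x \<and> discrete_line x (Suc k) = discrete_line b (Suc k)"
      using discrete_line_merge_Suc[OF a b k eq] by simp
  next
    assume h: "agree a k x \<and> discrete_line x (Suc k) = discrete_line b (Suc k)"
    have "x n i = ?c n i" if "(n, i) \<in> past_nodes ?c (Suc k)" for n i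
    proof (cases "(n, i) \<in> past_nodes ?c k")
      case True
      then show ?thesis using h by (auto simp: agree_def pc merge_def)
    next
      case False
      then have i: "i = line ?c n (Suc k)" and n: "1 \<le> n" "n \<le> Suc (top_level ?c (Suc k))"
        using that past_nodes_Suc[OF c b k] discrete_line_merge[OF a b k eq] eq
        by (auto simp: fresh_levels_def)
      have D: "discrete_line x (Suc k) = discrete_line ?c (Suc k)"
        using h discrete_line_merge_Suc[OF a b k eq] by simp
      have "top_level x (Suc k) = top_level ?c (Suc k)" using arg_cong[OF D, of length] by simp
      moreover have "line x n (Suc k) = line ?c n (Suc k)"
        using entry_index_discrete_line[OF x, of "Suc k" n] entry_index_discrete_line[OF c, of "Suc k" n] D by simp
      ultimately show ?thesis
        using entry_children_discrete_line[OF n(1), of x "Suc k"] entry_children_discrete_line[OF n, of] D n i by simp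
    qed
    then show "agree ?c (Suc k) x" by (auto simp: agree_def)
  }
qed

section \<open>From the crossings of a path to its forest\<close>

definition path_forest :: "(real \<Rightarrow> real) \<Rightarrow> forest" where
  "path_forest y n i = offspring y (int n) i"

lemma length_path_forest: "length (path_forest y n i) = num_offspring y (int n) i"
  by (simp add: path_forest_def num_offspring_def)

context crossing_path
begin

lemma branching_path_forest: "branching (path_forest y)"
  by (simp add: branching_def length_path_forest two_le_num_offspring)

lemma child_offset_path_forest: "child_offset (path_forest y) n q = refine_index (int n) q"
  by (simp add: child_offset_def length_path_forest refine_index_eq_sum)

lemma parent_path_forest_le_iff: "parent (path_forest y) n i \<le> q \<longleftrightarrow> i \<le> refine_index (int n) q"
  using parent_le_iff[OF branching_path_forest] by (simp add: child_offset_path_forest)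

text \<open>Iterating the Galois connection over the levels translates comparison of indices into
  comparison of end times, the form in which \<open>subcrossing\<close> is defined.\<close>

lemma line_path_forest_le_iff:
  "line (path_forest y) n k \<le> i \<longleftrightarrow> crossing_time y 0 k \<le> crossing_time y (int n) i"
proof (induction n arbitrary: i)
  case (Suc n)
  have "crossing_time y (int n) (refine_index (int (Suc n)) i) = crossing_time y (int (Suc n)) i"
    using crossing_time_refine_index[of "int (Suc n)" i] by simp
  then show ?case using Suc by (simp only: line.simps parent_path_forest_le_iff)
qed simp

lemma crossing_time_refine_0: "\<exists>i. crossing_time y 0 i = crossing_time y (int n) j"
proof (induction n arbitrary: j)
  case (Suc n)
  show ?case using Suc[of "refine_index (int (Suc n)) j"] crossing_time_refine_index[of "int (Suc n)" j] by simp
qed simp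

lemma subcrossing_0_iff:
  assumes "1 \<le> k"
  shows "subcrossing y 0 k (int n) j \<longleftrightarrow> j = line (path_forest y) n k"
proof -
  have pos: "1 \<le> line (path_forest y) n k" using line_pos[OF branching_path_forest assms] .
  \<comment> \<open>The start of a coarse crossing is itself a level 0 crossing time. Hence lying
    before time number \<open>k - 1\<close> is the same as not lying at or after time number
    \<open>k\<close>, and the lower bound becomes an upper bound for \<open>j - 1\<close>.\<close>
  have "crossing_time y (int n) (j - 1) \<le> crossing_time y 0 (k - 1) \<longleftrightarrow> \<not> line (path_forest y) n k \<le> j - 1"
  proof -
    obtain i where i: "crossing_time y 0 i = crossing_time y (int n) (j - 1)"
      using crossing_time_refine_0 by blast
    show ?thesis unfolding line_path_forest_le_iff i[symmetric] crossing_time_le_iff using assms by auto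
  qed
  then show ?thesis unfolding subcrossing_def line_path_forest_le_iff[symmetric] using assms pos by auto
qed

lemma ancestor_0_eq: "1 \<le> k \<Longrightarrow> ancestor y 0 (int n) k = line (path_forest y) n k"
  unfolding ancestor_def by (rule the_equality) (simp_all only: subcrossing_0_iff)

lemma line_length_eq: "1 \<le> k \<Longrightarrow> line_length y k = top_level (path_forest y) k"
  unfolding line_length_def top_level_def by (simp only: ancestor_0_eq Suc_eq_plus1)

lemma ancestor_Suc_eq:
  assumes "1 \<le> i"
  shows "ancestor y (int n) (int n + 1) i = parent (path_forest y) (Suc n) i"
proof -
  let ?q = "parent (path_forest y) (Suc n) i"
  have n: "int n + 1 = int (Suc n)" by simp
  have sub: "subcrossing y (int n) i (int (Suc n)) j \<longleftrightarrow> 1 \<le> j \<and> i \<in> children y (int (Suc n)) j" for j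
    by (auto simp: children_def subcrossing_def)
  have "subcrossing y (int n) i (int (Suc n)) j \<longleftrightarrow> j = ?q" for j
  proof
    assume "subcrossing y (int n) i (int (Suc n)) j"
    then have "1 \<le> j" "refine_index (int (Suc n)) (j - 1) < i" "i \<le> refine_index (int (Suc n)) j"
      using sub children_eq by (auto simp del: of_nat_Suc)
    then show "j = ?q"
      by (intro parent_eqI[OF branching_path_forest, symmetric]) (simp_all only: child_offset_path_forest)
  next
    assume "j = ?q"
    then show "subcrossing y (int n) i (int (Suc n)) j"
      unfolding sub using parent_bounds[OF branching_path_forest assms, of "Suc n"] children_eq[of ?q "int (Suc n)"]
      by (simp del: of_nat_Suc add: child_offset_path_forest)
  qed
  then show ?thesis unfolding ancestor_def n by (intro the_equality) simp_all
qed

lemma position_eq: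
  assumes "1 \<le> i"
  shows "position y (int n) i = sibling_pos (path_forest y) n i"
proof -
  let ?q = "parent (path_forest y) (Suc n) i"
  note bd = parent_bounds[OF branching_path_forest assms, of "Suc n", unfolded child_offset_path_forest]
  have "{j \<in> children y (int n + 1) ?q. j \<le> i} = {refine_index (int (Suc n)) (?q - 1)<..i}"
    using bd children_eq[OF bd(1), of "int (Suc n)"] by (auto simp: add.commute)
  then show ?thesis
    unfolding position_def ancestor_Suc_eq[OF assms] sibling_pos_def child_offset_path_forest by simp
qed

text \<open>\<open>descendant\<close> recurses from the root, whereas the tree property and
  \<open>node_address\<close> extend an address at its lower end.\<close>

lemma descendant_snoc:
  assumes "1 \<le> k"
  shows "descendant y n k (\<sigma> @ [j]) =
    (case descendant y n k \<sigma> of None \<Rightarrow> None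
     | Some q \<Rightarrow> if 1 \<le> j \<and> j \<le> num_offspring y (n - int (length \<sigma>)) q
         then Some (refine_index (n - int (length \<sigma>)) (q - 1) + j) else None)"
  using assms
proof (induction \<sigma> arbitrary: n k)
  case Nil
  then show ?case using nth_children[of k j n] by simp
next
  case (Cons c \<sigma>)
  show ?case
  proof (cases "1 \<le> c \<and> c \<le> num_offspring y n k")
    case True
    then have "1 \<le> sorted_list_of_set (children y n k) ! (c - 1)"
      using nth_children[OF Cons.prems, of c n] by simp
    moreover have "n - 1 - int (length \<sigma>) = n - int (length (c # \<sigma>))" by simp
    ultimately show ?thesis using Cons.IH[of _ "n - 1"] True
      by (simp only: append_Cons descendant.simps if_True simp_thms)
  qed auto
qed

end

definition discrete_part :: "line_entry \<Rightarrow> discrete_entry" where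
  "discrete_part e = (case e of (\<kappa>, S, Z, A, r) \<Rightarrow> (\<kappa>, S, Z, A))"

definition weight_part :: "line_entry \<Rightarrow> real list" where
  "weight_part e = snd (snd (snd (snd e)))"

lemma discrete_part_simp [simp]: "discrete_part (\<kappa>, S, Z, A, r) = (\<kappa>, S, Z, A)"
  by (simp add: discrete_part_def)

lemma ancestral_line_eq:
  assumes "crossing_path (\<lambda>t. Y t \<omega>)" "1 \<le> k"
  defines "a \<equiv> path_forest (\<lambda>t. Y t \<omega>)"
  shows "map discrete_part (ancestral_line Y R k \<omega>) = discrete_line a k" (is ?A)
    and "length (ancestral_line Y R k \<omega>) = Suc (top_level a k)"
    and "n \<le> top_level a k \<Longrightarrow> weight_part (ancestral_line Y R k \<omega> ! n) = R (int (Suc n)) (line a (Suc n) k) \<omega>"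
proof -
  interpret crossing_path "\<lambda>t. Y t \<omega>" by fact
  show "length (ancestral_line Y R k \<omega>) = Suc (top_level a k)"
    using line_length_eq[OF assms(2)] by (simp add: ancestral_line_def a_def)
  have "discrete_part (line_entry Y R n k \<omega>) = (line a n k, sibling_pos a n (line a n k),
       length (a (Suc n) (line a (Suc n) k)), a (Suc n) (line a (Suc n) k))"
     "weight_part (line_entry Y R n k \<omega>) = R (int (Suc n)) (line a (Suc n) k) \<omega>" for n
  proof -
    have 1: "ancestor (\<lambda>t. Y t \<omega>) 0 (int (n + 1)) k = line a (Suc n) k"
        "ancestor (\<lambda>t. Y t \<omega>) 0 (int n) k = line a n k"
      using ancestor_0_eq[OF assms(2), of "Suc n"] ancestor_0_eq[OF assms(2), of n] unfolding a_def by simp_all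
    have 2: "position (\<lambda>t. Y t \<omega>) (int n) (line a n k) = sibling_pos a n (line a n k)"
      unfolding a_def by (intro position_eq line_pos[OF branching_path_forest assms(2)])
    show "discrete_part (line_entry Y R n k \<omega>) = (line a n k, sibling_pos a n (line a n k),
       length (a (Suc n) (line a (Suc n) k)), a (Suc n) (line a (Suc n) k))"
     "weight_part (line_entry Y R n k \<omega>) = R (int (Suc n)) (line a (Suc n) k) \<omega>"
      unfolding line_entry_def 1 Let_def 2
      by (simp_all add: a_def path_forest_def num_offspring_def weight_part_def)
  qed
  note * = this
  show ?A
    using line_length_eq[OF assms(2)] by (simp add: ancestral_line_def discrete_line_def * a_def[symmetric] del: upt_Suc line.simps)
  show "weight_part (ancestral_line Y R k \<omega> ! n) = R (int (Suc n)) (line a (Suc n) k) \<omega>" if "n \<le> top_level a k"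
    using that line_length_eq[OF assms(2)] *(2)
    by (simp add: ancestral_line_def a_def[symmetric] del: upt_Suc line.simps)
qed

section \<open>Joint law of the marks\<close>

text \<open>The argument \<open>d\<close> is the number of levels up to the root. The base case does
  not look at the index, so the address is meaningful only if the ancestor reached there has index
  1, as \<open>ancestor_closed\<close> ensures.\<close>

primrec node_address :: "forest \<Rightarrow> nat \<Rightarrow> nat \<Rightarrow> nat \<Rightarrow> nat list" where
  "node_address a 0 n i = []"
| "node_address a (Suc d) n i = node_address a d (Suc n) (parent a (Suc n) i) @ [sibling_pos a n i]"

lemma length_node_address [simp]: "length (node_address a d n i) = d"
  by (induction d arbitrary: n i) auto

text \<open>The crossings to the left of a parent are included because children are numbered through
  all of their offspring vectors.\<close>

definition ancestor_closed :: "forest \<Rightarrow> nat \<Rightarrow> (nat \<times> nat) set \<Rightarrow> bool" where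
  "ancestor_closed a L I \<longleftrightarrow> finite I \<and> (L, 1) \<in> I \<and>
     (\<forall>(n, i) \<in> I. 1 \<le> n \<and> n \<le> L \<and> 1 \<le> i \<and> (n = L \<longrightarrow> i = 1) \<and>
        (n < L \<longrightarrow> (\<forall>q. 1 \<le> q \<and> q \<le> parent a (Suc n) i \<longrightarrow> (Suc n, q) \<in> I)))"

lemma ancestor_closedD:
  assumes "ancestor_closed a L I" "(n, i) \<in> I"
  shows "1 \<le> n" "n \<le> L" "1 \<le> i" "n = L \<Longrightarrow> i = 1"
    "\<And>q. n < L \<Longrightarrow> 1 \<le> q \<Longrightarrow> q \<le> parent a (Suc n) i \<Longrightarrow> (Suc n, q) \<in> I"
  using assms unfolding ancestor_closed_def by auto

lemma ancestor_closed_past_nodes: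
  assumes "branching a" "1 \<le> k"
  shows "ancestor_closed a (Suc (top_level a k)) (past_nodes a k)"
  unfolding ancestor_closed_def
  using finite_past_nodes[OF assms(1), of k] line_top[OF assms] past_nodes_parent[OF assms(1)]
  by (auto simp: past_nodes_def simp del: line.simps)

text \<open>The closure conditions only demand elements one level higher, hence never one of lowest
  level.\<close>

lemma ancestor_closed_remove:
  assumes "ancestor_closed a L I" "(n, i) \<in> I" "n < L" "\<forall>(m, q) \<in> I. n \<le> m"
  shows "ancestor_closed a L (I - {(n, i)})"
proof -
  have "(Suc m, r) \<noteq> (n, i)" if "(m, q) \<in> I" for m q r
    using assms(4) that by fastforce
  then show ?thesis using assms(1,3) unfolding ancestor_closed_def by auto
qed

lemma (in crossing_path) descendant_node_address:
  assumes a: "branching a" and I: "ancestor_closed a L I" and "(n, i) \<in> I"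
    and "\<And>m q. (m, q) \<in> I \<Longrightarrow> n < m \<Longrightarrow> path_forest y m q = a m q"
  shows "descendant y (int L) 1 (node_address a (L - n) n i) = Some i"
  using assms(3,4)
proof (induction "L - n" arbitrary: n i)
  case 0
  then have "n = L" "i = 1" using ancestor_closedD[OF I, of n i] by auto
  then show ?case by simp
next
  case (Suc d)
  note cl = ancestor_closedD[OF I Suc.prems(1)]
  have d: "d = L - Suc n" "L - n = Suc d" "n < L" using Suc(2) by simp_all
  let ?q = "parent a (Suc n) i"
  note q = parent_bounds[OF a cl(3), of "Suc n"]
  have eq: "path_forest y (Suc n) r = a (Suc n) r" if "1 \<le> r" "r \<le> ?q" for r
    using Suc.prems(2)[OF cl(5)] d that by auto
  have IH: "descendant y (int L) 1 (node_address a d (Suc n) ?q) = Some ?q"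
    unfolding d(1) using cl(5)[of ?q] q d Suc.prems(2) by (intro Suc(1)) auto
  have lvl: "int L - int (length (node_address a d (Suc n) ?q)) = int (Suc n)" using d by simp
  have "num_offspring y (int (Suc n)) ?q = length (a (Suc n) ?q)"
    using eq[of ?q] q length_path_forest[of y "Suc n" ?q] by simp
  moreover have "refine_index (int (Suc n)) (?q - 1) = child_offset a (Suc n) (?q - 1)"
    unfolding child_offset_path_forest[symmetric] using eq q by (intro child_offset_cong) auto
  ultimately show ?case
    using sibling_pos_bounds[OF a cl(3), of n]
    unfolding d(2) node_address.simps descendant_snoc[OF order.refl] IH lvl
    by (simp del: of_nat_Suc)
qed

lemma space_list_space [simp]: "space (list_space S) = lists (space S)"
  unfolding list_space_def by (rule space_measure_of_conv)

lemma space_mark_space [simp]: "space mark_space = UNIV"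
  by (simp add: mark_space_def space_pair_measure)

lemma mark_space_sets:
  assumes "B \<in> sets (list_space borel)"
  shows "{(t, A, r). A = x \<and> r \<in> B} \<in> sets mark_space"
    and "{(t, A, r). t = i \<and> A = x \<and> r \<in> B} \<in> sets mark_space"
    and "{(t, A, r). t = i} \<in> sets mark_space"
proof -
  have 1: "{(t, A, r). A = x \<and> r \<in> B} = UNIV \<times> {x} \<times> B"
    and 2: "{(t, A, r). t = i \<and> A = x \<and> r \<in> B} = {i} \<times> {x} \<times> B"
    and 3: "{(t, A, r). t = i} = {i} \<times> UNIV \<times> space (list_space borel :: real list measure)"
    by auto
  show "{(t, A, r). A = x \<and> r \<in> B} \<in> sets mark_space"
    "{(t, A, r). t = i \<and> A = x \<and> r \<in> B} \<in> sets mark_space"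
    "{(t, A, r). t = i} \<in> sets mark_space"
    unfolding 1 2 3 mark_space_def using assms by (intro pair_measureI sets.top; simp)+
qed

section \<open>Probabilities of prescribed marks\<close>

locale mebp_process = prob_space M
  for p :: "orient \<Rightarrow> orient list pmf"
    and F :: "orient \<Rightarrow> orient list \<Rightarrow> real list measure"
    and astar :: real
    and M :: "'w measure"
    and Y :: "real \<Rightarrow> 'w \<Rightarrow> real"
    and R :: "int \<Rightarrow> nat \<Rightarrow> 'w \<Rightarrow> real list" +
  assumes p: "orientation_distributions p" and mebp: "mebp p F astar M Y R"
begin

abbreviation forest :: "'w \<Rightarrow> forest" where
  "forest \<omega> \<equiv> path_forest (\<lambda>t. Y t \<omega>)"

abbreviation tree :: "nat \<Rightarrow> nat list \<Rightarrow> 'w \<Rightarrow> mark option" where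
  "tree L \<equiv> first_crossing_tree Y R (int L)"

definition root_prob :: "nat \<Rightarrow> orient \<Rightarrow> real" where
  "root_prob L t = measure M (mark_event M (tree L) [] {(i, A, r). i = t})"

definition mark_prob :: "orient \<Rightarrow> orient list \<Rightarrow> real list set \<Rightarrow> real" where
  "mark_prob t A B = pmf (p t) A * measure (F t A) B"

definition cylinder :: "(nat \<times> nat) set \<Rightarrow> forest \<Rightarrow> (nat \<Rightarrow> nat \<Rightarrow> real list set) \<Rightarrow> 'w set" where
  "cylinder I a B = {\<omega> \<in> space M. \<forall>(n, i) \<in> I. forest \<omega> n i = a n i \<and> R (int n) i \<omega> \<in> B n i}"

lemma crossing_path: "\<omega> \<in> space M \<Longrightarrow> crossing_path (\<lambda>t. Y t \<omega>)"
  using mebp by (simp add: mebp_def crossing_path_def)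

lemma branching_forest: "\<omega> \<in> space M \<Longrightarrow> branching (forest \<omega>)"
  using crossing_path crossing_path.branching_path_forest by blast

lemma galton_watson: "marked_galton_watson p F astar M (tree L)"
  using mebp by (simp add: mebp_def)

lemma mark_event_sets: "B \<in> sets mark_space \<Longrightarrow> mark_event M (tree L) \<sigma> B \<in> sets M"
  using galton_watson[of L] by (simp add: marked_galton_watson_def)

lemma child_node:
  assumes "\<omega> \<in> space M" "tree L \<sigma> \<omega> = Some (t, A, r)" "1 \<le> j" "j \<le> length A"
  shows "\<exists>A' r'. tree L (\<sigma> @ [j]) \<omega> = Some (A ! (j - 1), A', r')"
proof -
  have "\<forall>\<omega> \<in> space M. \<forall>\<sigma> j. case tree L \<sigma> \<omega> of
        None \<Rightarrow> tree L (\<sigma> @ [j]) \<omega> = None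
      | Some (i, A, R) \<Rightarrow>
          (if 1 \<le> j \<and> j \<le> length A
           then \<exists>A' R'. tree L (\<sigma> @ [j]) \<omega> = Some (A ! (j - 1), A', R')
           else tree L (\<sigma> @ [j]) \<omega> = None)"
    using galton_watson[of L] unfolding marked_galton_watson_def by blast
  from this[rule_format, OF assms(1), of \<sigma> j] show ?thesis using assms by simp
qed

lemma mark_law:
  assumes "E \<in> nondescendant_events M (tree L) \<sigma>" "B \<in> sets (list_space borel)"
  shows "measure M (E \<inter> mark_event M (tree L) \<sigma> {(i', A, r). i' = i \<and> A = a \<and> r \<in> B}) =
    measure M (E \<inter> mark_event M (tree L) \<sigma> {(i', A, r). i' = i}) * mark_prob i a B"
proof -
  have "\<forall>\<sigma> i a. \<forall>E \<in> nondescendant_events M (tree L) \<sigma>. \<forall>B \<in> sets (list_space borel).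
        measure M (E \<inter> mark_event M (tree L) \<sigma> {(i', A, R). i' = i \<and> A = a \<and> R \<in> B}) =
        measure M (E \<inter> mark_event M (tree L) \<sigma> {(i', A, R). i' = i}) * pmf (p i) a * measure (F i a) B"
    using galton_watson[of L] unfolding marked_galton_watson_def by blast
  from this[rule_format, OF assms] show ?thesis unfolding mark_prob_def by (simp only: mult.assoc)
qed

text \<open>Vectors in the support of \<open>p t\<close> end in the pair \<open>t\<close>,
  \<open>t\<close>. The lemma serves to discard incompatible types as factors equal to 0.\<close>

lemma mark_prob_last: "mark_prob t A B \<noteq> 0 \<Longrightarrow> last A = t"
proof -
  assume "mark_prob t A B \<noteq> 0"
  then have "A \<in> set_pmf (p t)" by (auto simp: mark_prob_def set_pmf_iff)
  then have "A \<in> offspring_vectors t" using p by (auto simp: orientation_distributions_def)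
  then show ?thesis by (auto simp: offspring_vectors_def)
qed

lemma tree_eq:
  assumes "descendant (\<lambda>t. Y t \<omega>) (int L) 1 \<sigma> = Some i" "int L - int (length \<sigma>) = int n"
  shows "tree L \<sigma> \<omega> = Some (crossing_orient (\<lambda>t. Y t \<omega>) (int n) i, forest \<omega> n i, R (int n) i \<omega>)"
  using assms by (simp add: first_crossing_tree_def crossing_mark_def path_forest_def)

context
  fixes a :: forest and L :: nat and I :: "(nat \<times> nat) set"
  assumes a: "branching a" and I: "ancestor_closed a L I"
begin

abbreviation address :: "nat \<times> nat \<Rightarrow> nat list" where
  "address z \<equiv> node_address a (L - fst z) (fst z) (snd z)"

lemma tree_address:
  assumes "\<omega> \<in> space M" "(n, i) \<in> I" "\<And>m q. (m, q) \<in> I \<Longrightarrow> n < m \<Longrightarrow> forest \<omega> m q = a m q"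
  shows "tree L (address (n, i)) \<omega> = Some (crossing_orient (\<lambda>t. Y t \<omega>) (int n) i, forest \<omega> n i, R (int n) i \<omega>)"
  using crossing_path.descendant_node_address[OF crossing_path[OF assms(1)] a I assms(2,3)]
    ancestor_closedD(2)[OF I assms(2)] by (intro tree_eq) auto

text \<open>The inclusion from right to left descends from the root: an address is known to lead to
  its crossing only after the vectors of all higher levels have been identified.\<close>

lemma cylinder_eq_mark_events:
  "cylinder I a B = (\<Inter>z\<in>I. mark_event M (tree L) (address z) {(t, A, r). A = a (fst z) (snd z) \<and> r \<in> B (fst z) (snd z)})"
  (is "_ = (\<Inter>z\<in>I. ?E z)")
proof
  show "cylinder I a B \<subseteq> (\<Inter>z\<in>I. ?E z)"
  proof
    fix \<omega> assume w: "\<omega> \<in> cylinder I a B"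
    show "\<omega> \<in> (\<Inter>z\<in>I. ?E z)"
    proof
      fix z assume z: "z \<in> I"
      have "tree L (address (fst z, snd z)) \<omega> = Some (crossing_orient (\<lambda>t. Y t \<omega>) (int (fst z)) (snd z),
          forest \<omega> (fst z) (snd z), R (int (fst z)) (snd z) \<omega>)"
        using w z by (intro tree_address) (auto simp: cylinder_def)
      then show "\<omega> \<in> ?E z"
        using w z by (auto simp: cylinder_def mark_event_def)
    qed
  qed
  show "(\<Inter>z\<in>I. ?E z) \<subseteq> cylinder I a B"
  proof
    fix \<omega> assume w: "\<omega> \<in> (\<Inter>z\<in>I. ?E z)"
    have sp: "\<omega> \<in> space M"
      using w I by (auto simp: ancestor_closed_def mark_event_def)
    have "forest \<omega> n i = a n i \<and> R (int n) i \<omega> \<in> B n i" if "(n, i) \<in> I" for n i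
      using that
    proof (induction "L - n" arbitrary: n i rule: less_induct)
      case less
      have "tree L (address (n, i)) \<omega> = Some (crossing_orient (\<lambda>t. Y t \<omega>) (int n) i, forest \<omega> n i, R (int n) i \<omega>)"
      proof (rule tree_address[OF sp less(2)])
        show "forest \<omega> m q = a m q" if "(m, q) \<in> I" "n < m" for m q
          using less(1)[of m q] that ancestor_closedD(2)[OF I that(1)] by simp
      qed
      moreover have "\<omega> \<in> ?E (n, i)" using w less(2) by blast
      ultimately show ?case by (auto simp: mark_event_def)
    qed
    then show "\<omega> \<in> cylinder I a B" using sp by (auto simp: cylinder_def)
  qed
qed

lemma cylinder_sets:
  assumes "\<And>n i. B n i \<in> sets (list_space borel)"
  shows "cylinder I a B \<in> sets M"
proof -
  have "I \<noteq> {}" "finite I" using I by (auto simp: ancestor_closed_def)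
  then show ?thesis unfolding cylinder_eq_mark_events
    by (intro sets.finite_INT mark_event_sets mark_space_sets assms) auto
qed

end

text \<open>A crossing of lowest level has no descendant among the others, so the rest of the
  cylinder is an event independent of its pair, given its type. The type is fixed by the prescribed
  vector of its parent, and exactly one factor splits off.\<close>

lemma cylinder_insert:
  assumes a: "branching a" and I: "ancestor_closed a L I" and z: "(n, i) \<in> I" "n < L"
    and min: "\<forall>(m, q) \<in> I. n \<le> m"
    and B: "\<And>n i. B n i \<in> sets (list_space borel)"
  shows "prob (cylinder I a B) = prob (cylinder (I - {(n, i)}) a B) * mark_prob (node_type a n i) (a n i) (B n i)"
proof -
  let ?I = "I - {(n, i)}" and ?t = "node_type a n i"
  let ?adr = "\<lambda>z. node_address a (L - fst z) (fst z) (snd z)"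
  let ?\<sigma> = "?adr (n, i)"
  note I' = ancestor_closed_remove[OF I z min]
  note cl = ancestor_closedD[OF I z(1)]
  have sub: "cylinder I a B \<subseteq> cylinder ?I a B" by (auto simp: cylinder_def)
  show ?thesis
  proof (cases "cylinder ?I a B = {}")
    case True
    then show ?thesis using sub by simp
  next
    case False
    then obtain \<omega>0 where w0: "\<omega>0 \<in> cylinder ?I a B" by blast
    have up: "forest \<omega> m q = a m q" if "\<omega> \<in> cylinder ?I a B" "(m, q) \<in> I" "n < m" for \<omega> m q
      using that by (auto simp: cylinder_def)
    \<comment> \<open>A prefix of an address belongs to the same or a higher level, so by minimality
      the levels and then the addresses coincide. At the path \<open>\<omega>0\<close> an address
      leads to only one crossing, a contradiction.\<close>
    have nondesc: "\<not> prefix ?\<sigma> (?adr z)" if "z \<in> ?I" for z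
    proof
      assume pre: "prefix ?\<sigma> (?adr z)"
      obtain m q where mq: "z = (m, q)" by force
      have "n \<le> m" "m \<le> L" using min ancestor_closedD(2)[OF I, of m q] that mq by auto
      then have mn: "m = n" using prefix_length_le[OF pre] z(2) mq by auto
      then have len: "length (?adr z) = length ?\<sigma>" using mq by simp
      obtain zs where zs: "?adr z = ?\<sigma> @ zs" using pre by (auto simp: prefix_def)
      then have "zs = []" using arg_cong[OF zs, of length] len by simp
      then have eq: "?adr z = ?\<sigma>" using zs by simp
      have "descendant (\<lambda>t. Y t \<omega>0) (int L) 1 (?adr (n, r)) = Some r" if "(n, r) \<in> I" for r
        using w0 up[OF w0] crossing_path that unfolding fst_conv snd_conv
        by (intro crossing_path.descendant_node_address[OF _ a I]) (auto simp: cylinder_def)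
      from this[of i] this[of q] show False using that z mq mn eq by auto
    qed
    let ?E = "\<lambda>z. mark_event M (tree L) (?adr z) {(t, A, r). A = a (fst z) (snd z) \<and> r \<in> B (fst z) (snd z)}"
    have nd: "cylinder ?I a B \<in> nondescendant_events M (tree L) ?\<sigma>"
    proof -
      interpret N: sigma_algebra "space M" "nondescendant_events M (tree L) ?\<sigma>"
        unfolding nondescendant_events_def by (rule sigma_algebra_sigma_sets) (auto simp: mark_event_def)
      have "?E z \<in> nondescendant_events M (tree L) ?\<sigma>" if "z \<in> ?I" for z
        unfolding nondescendant_events_def
        by (rule sigma_sets.Basic) (use nondesc[OF that] mark_space_sets(1)[OF B] in blast)
      moreover have "finite ?I" "?I \<noteq> {}" using I' by (auto simp: ancestor_closed_def)
      ultimately show ?thesis unfolding cylinder_eq_mark_events[OF a I'] by (intro N.finite_INT)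
    qed
    have node: "tree L ?\<sigma> \<omega> = Some (?t, forest \<omega> n i, R (int n) i \<omega>)" if w: "\<omega> \<in> cylinder ?I a B" for \<omega>
    proof -
      let ?q = "parent a (Suc n) i"
      have sp: "\<omega> \<in> space M" using w by (simp add: cylinder_def)
      note q = parent_bounds[OF a cl(3), of "Suc n"]
      note s = sibling_pos_bounds[OF a cl(3), of n]
      have qI: "(Suc n, ?q) \<in> I" using cl(5)[OF z(2), of ?q] q by simp
      have 1: "tree L (?adr (Suc n, ?q)) \<omega> =
          Some (crossing_orient (\<lambda>t. Y t \<omega>) (int (Suc n)) ?q, a (Suc n) ?q, R (int (Suc n)) ?q \<omega>)"
        using tree_address[OF a I sp qI] up[OF w] qI by simp
      have "L - n = Suc (L - Suc n)" using z(2) by simp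
      then have "?\<sigma> = ?adr (Suc n, ?q) @ [sibling_pos a n i]" by simp
      then have "\<exists>A r. tree L ?\<sigma> \<omega> = Some (?t, A, r)"
        using child_node[OF sp 1 s(1,2)] by (simp add: node_type_def)
      moreover have "tree L ?\<sigma> \<omega> = Some (crossing_orient (\<lambda>t. Y t \<omega>) (int n) i, forest \<omega> n i, R (int n) i \<omega>)"
        using tree_address[OF a I sp z(1)] up[OF w] by simp
      ultimately show "tree L ?\<sigma> \<omega> = Some (?t, forest \<omega> n i, R (int n) i \<omega>)" by simp
    qed
    have sp: "\<omega> \<in> space M" if "\<omega> \<in> cylinder ?I a B" for \<omega> using that by (simp add: cylinder_def)
    have "cylinder ?I a B \<inter> mark_event M (tree L) ?\<sigma> {(i', A, r). i' = ?t \<and> A = a n i \<and> r \<in> B n i} = cylinder I a B"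
    proof -
      have "\<omega> \<in> cylinder I a B \<longleftrightarrow> \<omega> \<in> cylinder ?I a B \<and> forest \<omega> n i = a n i \<and> R (int n) i \<omega> \<in> B n i" for \<omega>
        using z(1) by (auto simp: cylinder_def)
      then show ?thesis using node sp by (auto simp: mark_event_def)
    qed
    moreover have "cylinder ?I a B \<inter> mark_event M (tree L) ?\<sigma> {(i', A, r). i' = ?t} = cylinder ?I a B"
      using node sp by (auto simp: mark_event_def)
    ultimately show ?thesis using mark_law[OF nd B, of ?t "a n i" n i] by simp
  qed
qed

text \<open>The type of a crossing is almost surely the last entry of its offspring vector.\<close>

lemma cylinder_root:
  assumes a: "branching a" and I: "ancestor_closed a L {(L, 1)}"
    and B: "\<And>n i. B n i \<in> sets (list_space borel)"
  shows "prob (cylinder {(L, 1)} a B) = root_prob L (last (a L 1)) * mark_prob (last (a L 1)) (a L 1) (B L 1)"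
proof -
  let ?E = "\<lambda>t. mark_event M (tree L) [] {(i', A, r). i' = t \<and> A = a L 1 \<and> r \<in> B L 1}"
  have E: "prob (?E t) = root_prob L t * mark_prob t (a L 1) (B L 1)" for t
  proof -
    have "mark_event M (tree L) [] S \<subseteq> space M" for S by (auto simp: mark_event_def)
    then show ?thesis
      using mark_law[of "space M" L "[]" "B L 1" t "a L 1"] B
      by (simp add: root_prob_def nondescendant_events_def sigma_sets_top Int_absorb1)
  qed
  have other: "mark_prob t (a L 1) (B L 1) = 0" if "t \<noteq> last (a L 1)" for t
    using mark_prob_last that by blast
  have fin: "finite (UNIV :: orient set)"
    by (rule finite_subset[of _ "{Up, Down}"]) (use orient.exhaust in auto)
  have "cylinder {(L, 1)} a B = (\<Union>t\<in>UNIV. ?E t)"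
    unfolding cylinder_eq_mark_events[OF a I] by (auto simp: mark_event_def)
  moreover have "prob (\<Union>t\<in>UNIV. ?E t) = (\<Sum>t\<in>UNIV. prob (?E t))"
  proof (rule finite_measure_finite_Union[OF fin])
    show "?E ` UNIV \<subseteq> sets M" by (intro image_subsetI mark_event_sets mark_space_sets B)
    show "disjoint_family ?E" by (auto simp: disjoint_family_on_def mark_event_def)
  qed
  moreover have "(\<Sum>t\<in>UNIV. prob (?E t)) = prob (?E (last (a L 1)))"
    unfolding E using other by (subst sum.remove[OF fin, of "last (a L 1)"]) (auto intro!: sum.neutral)
  ultimately show ?thesis by (simp only: E)
qed

text \<open>Crossings of lowest level are removed until only the root is left. The root has no
  parent in the set, so its type is taken from its own vector.\<close>

lemma cylinder_prob:
  assumes a: "branching a" and I: "ancestor_closed a L I"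
    and B: "\<And>n i. B n i \<in> sets (list_space borel)"
  shows "prob (cylinder I a B) = root_prob L (last (a L 1)) *
    (\<Prod>(n, i) \<in> I. mark_prob (if n = L then last (a L 1) else node_type a n i) (a n i) (B n i))"
  using I
proof (induction "card I" arbitrary: I rule: less_induct)
  case less
  note I = less(2)
  then have fin: "finite I" and root: "(L, 1) \<in> I" by (auto simp: ancestor_closed_def)
  show ?case
  proof (cases "I = {(L, 1)}")
    case True
    then show ?thesis using cylinder_root[OF a _ B, of L] I by simp
  next
    case False
    define n where "n = Min (fst ` I)"
    have "n \<in> fst ` I" unfolding n_def using fin root by (intro Min_in) auto
    then obtain i where z: "(n, i) \<in> I" by auto
    have min: "\<forall>(m, q) \<in> I. n \<le> m"
    proof clarify
      fix m q assume "(m, q) \<in> I"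
      then have "m \<in> fst ` I" by force
      then show "n \<le> m" unfolding n_def using fin by simp
    qed
    have nL: "n < L"
    proof (rule ccontr)
      assume "\<not> n < L"
      then have "m = L \<and> q = 1" if "(m, q) \<in> I" for m q
        using min ancestor_closedD(2,4)[OF I that] that by fastforce
      then have "I \<subseteq> {(L, 1)}" by auto
      then show False using False root by blast
    qed
    have "card (I - {(n, i)}) < card I" using z fin by (rule card_Diff1_less[rotated])
    note IH = less(1)[OF this ancestor_closed_remove[OF I z nL min]]
    define g where "g = (\<lambda>(n, i). mark_prob (if n = L then last (a L 1) else node_type a n i) (a n i) (B n i))"
    have IH': "prob (cylinder (I - {(n, i)}) a B) = root_prob L (last (a L 1)) * prod g (I - {(n, i)})"
      unfolding g_def by (rule IH)
    have g: "g (n, i) = mark_prob (node_type a n i) (a n i) (B n i)"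
      using nL by (simp add: g_def)
    have "prob (cylinder I a B) = root_prob L (last (a L 1)) * (prod g (I - {(n, i)}) * g (n, i))"
      unfolding cylinder_insert[OF a I z nL min B] IH' g by (rule mult.assoc)
    also have "prod g (I - {(n, i)}) * g (n, i) = prod g I"
      using prod.remove[OF fin z, of g] by (simp only: mult.commute)
    finally show ?thesis unfolding g_def .
  qed
qed

end

section \<open>A criterion for the Markov property\<close>

text \<open>Both sides are values of finite measures, the densities restricted to the generated
  sigma-algebra, which agree on an intersection-stable generator. The countable cover makes up for a
  generator without the whole space.\<close>

lemma set_integral_eq_on_sigma_sets:
  fixes f g :: "'a \<Rightarrow> real"
  assumes G: "Int_stable G" "G \<subseteq> sets M" and cover: "C \<subseteq> G" "countable C" "\<Union>C = space M"
    and f: "integrable M f" "AE x in M. 0 \<le> f x" and g: "integrable M g" "AE x in M. 0 \<le> g x"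
    and eq: "\<And>A. A \<in> G \<Longrightarrow> (LINT x:A|M. f x) = (LINT x:A|M. g x)"
    and A: "A \<in> sigma_sets (space M) G"
  shows "(LINT x:A|M. f x) = (LINT x:A|M. g x)"
proof -
  let ?S = "sigma (space M) G"
  have GP: "G \<subseteq> Pow (space M)" using G(2) sets.space_closed by blast
  have sets_S: "sets ?S = sigma_sets (space M) G" using GP by (rule sets_measure_of)
  have sub: "sigma_sets (space M) G \<subseteq> sets M" using G(2) by (rule sets.sigma_sets_subset)
  have sub': "subalgebra (density M h) ?S" for h
    unfolding subalgebra_def sets_S using sub by (simp add: space_measure_of_conv)
  have em: "emeasure (restr_to_subalg (density M (\<lambda>x. ennreal (h x))) ?S) B = ennreal (LINT x:B|M. h x)"
    if h: "integrable M h" "AE x in M. 0 \<le> h x" and B: "B \<in> sigma_sets (space M) G" for h :: "'a \<Rightarrow> real" and B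
  proof -
    have BM: "B \<in> sets M" using B sub by blast
    have "emeasure (restr_to_subalg (density M (\<lambda>x. ennreal (h x))) ?S) B = emeasure (density M (\<lambda>x. ennreal (h x))) B"
      using B sets_S by (intro emeasure_restr_to_subalg sub') simp
    also have "\<dots> = (\<integral>\<^sup>+ x. ennreal (h x) * indicator B x \<partial>M)"
      using h BM by (intro emeasure_density) auto
    also have "\<dots> = (\<integral>\<^sup>+ x. ennreal (indicator B x *\<^sub>R h x) \<partial>M)"
      by (intro nn_integral_cong) (auto simp: indicator_def)
    also have "\<dots> = ennreal (LINT x:B|M. h x)"
      unfolding set_lebesgue_integral_def using h BM
      by (intro nn_integral_eq_integral integrable_mult_indicator) auto
    finally show ?thesis .
  qed
  have "restr_to_subalg (density M (\<lambda>x. ennreal (f x))) ?S = restr_to_subalg (density M (\<lambda>x. ennreal (g x))) ?S"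
  proof (rule measure_eqI_generator_eq_countable[OF G(1) GP _ _ _ cover(1,3,2)])
    show "emeasure (restr_to_subalg (density M (\<lambda>x. ennreal (f x))) ?S) B =
        emeasure (restr_to_subalg (density M (\<lambda>x. ennreal (g x))) ?S) B" if "B \<in> G" for B
      using em[OF f] em[OF g] eq[OF that] that by simp
    show "emeasure (restr_to_subalg (density M (\<lambda>x. ennreal (f x))) ?S) B \<noteq> \<infinity>" if "B \<in> C" for B
      using em[OF f, of B] cover(1) that by auto
  qed (use sets_restr_to_subalg[OF sub'] sets_S in auto)
  then have "ennreal (LINT x:A|M. f x) = ennreal (LINT x:A|M. g x)"
    using em[OF f A] em[OF g A] by simp
  moreover have "0 \<le> (LINT x:A|M. h x)" if "AE x in M. 0 \<le> h x" for h :: "'a \<Rightarrow> real"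
    unfolding set_lebesgue_integral_def using that by (intro integral_nonneg_AE) auto
  ultimately show ?thesis using f(2) g(2) by simp
qed

context prob_space
begin

lemma set_integral_indicator:
  "A \<in> events \<Longrightarrow> B \<in> events \<Longrightarrow> (LINT x:A|M. indicator B x) = prob (A \<inter> B)"
  by (simp add: set_lebesgue_integral_def indicator_inter_arith[symmetric] Int_absorb1)

text \<open>
  The claim is equivalent to \<open>LINT \<omega>:V|M. indicator A \<omega> = LINT \<omega>:V|M. real_cond_exp M N (indicator A) \<omega>\<close>
  for all \<open>A \<in> sets P\<close> and \<open>V = X' -` B\<close>. In this form \<open>B\<close> enters only as a domain of integration, so
  that it suffices to consider \<open>B\<close> in the generator \<open>G\<close>.
\<close>

lemma markov_step_generator:
  assumes subalg: "subalgebra M P" "subalgebra P N"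
    and X': "X' \<in> measurable M S"
    and G: "Int_stable G" "G \<subseteq> Pow (space S)" "sets S = sigma_sets (space S) G"
    and coverG: "CG \<subseteq> G" "countable CG" "\<Union>CG = space S"
    and step: "\<And>B. B \<in> G \<Longrightarrow> \<exists>h. h \<in> borel_measurable N \<and> integrable M h \<and>
         (\<forall>A \<in> sets P. prob (A \<inter> (X' -` B \<inter> space M)) = (LINT \<omega>:A|M. h \<omega>))"
    and B: "B \<in> sets S"
  shows "AE \<omega> in M. real_cond_exp M P (indicator (X' -` B \<inter> space M)) \<omega> =
    real_cond_exp M N (indicator (X' -` B \<inter> space M)) \<omega>"
proof -
  have NM: "subalgebra M N" using subalg by (auto simp: subalgebra_def)
  interpret P: finite_measure_subalgebra M P by unfold_locales (rule subalg)
  interpret N: finite_measure_subalgebra M N by unfold_locales (rule NM)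
  let ?V = "\<lambda>B. X' -` B \<inter> space M"
  have V: "?V B \<in> sets M" if "B \<in> sets S" for B using X' that by (rule measurable_sets)
  have VG: "?V B \<in> sets M" if "B \<in> G" for B using V that G(3) by auto
  have PM: "A \<in> sets M" if "A \<in> sets P" for A using subalg(1) that by (auto simp: subalgebra_def)
  have NP: "A \<in> sets P" if "A \<in> sets N" for A using subalg(2) that by (auto simp: subalgebra_def)
  have int: "integrable M (indicator A :: _ \<Rightarrow> real)" if "A \<in> sets M" for A
    using that by (intro integrable_const_bound[of _ 1]) (auto simp: indicator_def)
  have split: "(LINT \<omega>:?V B|M. indicator A \<omega>) = (LINT \<omega>:?V B|M. real_cond_exp M N (indicator A) \<omega>)"
    if A: "A \<in> sets P" and B: "B \<in> sets S" for A B
  proof (rule set_integral_eq_on_sigma_sets[where G = "?V ` G" and C = "?V ` CG" and M = M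
        and f = "indicator A" and g = "real_cond_exp M N (indicator A)" and A = "?V B"])
    show "Int_stable (?V ` G)"
    proof (rule Int_stableI_image)
      fix B B' assume h: "B \<in> G" "B' \<in> G"
      show "\<exists>k\<in>G. ?V B \<inter> ?V B' = ?V k"
        by (rule bexI[OF _ Int_stableD[OF G(1) h]]) auto
    qed
    show "?V ` G \<subseteq> sets M" using VG by auto
    show "?V ` CG \<subseteq> ?V ` G" using coverG by auto
    show "countable (?V ` CG)" using coverG by simp
    show "\<Union> (?V ` CG) = space M"
      using coverG(3) measurable_space[OF X'] by fastforce
    show "?V B \<in> sigma_sets (space M) (?V ` G)"
    proof -
      have "X' \<in> space M \<rightarrow> space S" using measurable_space[OF X'] by auto
      from sigma_sets_vimage_commute[OF this, of G] have "?V B \<in> sigma_sets (space M) {?V B |B. B \<in> G}"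
        using B unfolding G(3) by blast
      moreover have "{?V B |B. B \<in> G} = ?V ` G" by auto
      ultimately show ?thesis by simp
    qed
    show "integrable M (indicator A :: _ \<Rightarrow> real)" by (rule int[OF PM[OF A]])
    then show "integrable M (real_cond_exp M N (indicator A))" by (rule N.real_cond_exp_int)
    show "AE \<omega> in M. 0 \<le> (indicator A \<omega> :: real)" by simp
    show "AE \<omega> in M. 0 \<le> real_cond_exp M N (indicator A) \<omega>"
      using PM[OF A] by (intro N.real_cond_exp_pos) auto
  next
    fix W assume "W \<in> ?V ` G"
    then obtain B where B: "B \<in> G" and W: "W = ?V B" by blast
    obtain h where h: "h \<in> borel_measurable N" "integrable M h"
      and hA: "\<And>A. A \<in> sets P \<Longrightarrow> prob (A \<inter> ?V B) = (LINT \<omega>:A|M. h \<omega>)"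
      using step[OF B] by blast
    let ?fA = "real_cond_exp M N (indicator A)" and ?fV = "real_cond_exp M N (indicator (?V B))"
    \<comment> \<open>Every set of \<open>N\<close> belongs to \<open>P\<close>, so the property of
      \<open>h\<close> makes it a version of the conditional probability given
      \<open>N\<close>.\<close>
    have hV: "AE \<omega> in M. ?fV \<omega> = h \<omega>"
    proof (rule N.real_cond_exp_charact[OF _ int[OF VG[OF B]] h(2,1)])
      fix A' assume "A' \<in> sets N"
      then have A': "A' \<in> sets P" by (rule NP)
      show "(LINT \<omega>:A'|M. indicator (?V B) \<omega>) = (LINT \<omega>:A'|M. h \<omega>)"
        using hA[OF A'] set_integral_indicator[OF PM[OF A'] VG[OF B]] by simp
    qed
    \<comment> \<open>Conditional expectation given \<open>N\<close> is self-adjoint: it is moved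
      from the indicator of \<open>A\<close> to that of \<open>?V B\<close>, replaced there by
      \<open>h\<close>, and dropped from \<open>A\<close>.\<close>
    have "(LINT \<omega>:?V B|M. ?fA \<omega>) = (\<integral>\<omega>. ?fA \<omega> * indicator (?V B) \<omega> \<partial>M)"
      by (simp add: set_lebesgue_integral_def mult.commute)
    also have "\<dots> = (\<integral>\<omega>. ?fA \<omega> * ?fV \<omega> \<partial>M)"
      using integrable_mult_indicator[OF VG[OF B] N.real_cond_exp_int(1)[OF int[OF PM[OF A]]]] VG[OF B]
      by (intro N.real_cond_exp_intg(2)[symmetric]) (auto simp: mult.commute)
    also have "\<dots> = (\<integral>\<omega>. h \<omega> * ?fA \<omega> \<partial>M)"
    proof (rule integral_cong_AE)
      have "h \<in> borel_measurable M" using NM h(1) by (rule measurable_from_subalg)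
      then show "(\<lambda>\<omega>. h \<omega> * ?fA \<omega>) \<in> borel_measurable M" by measurable
      show "(\<lambda>\<omega>. ?fA \<omega> * ?fV \<omega>) \<in> borel_measurable M" by measurable
      show "AE \<omega> in M. ?fA \<omega> * ?fV \<omega> = h \<omega> * ?fA \<omega>" using hV by eventually_elim simp
    qed
    also have "\<dots> = (\<integral>\<omega>. h \<omega> * indicator A \<omega> \<partial>M)"
      using integrable_mult_indicator[OF PM[OF A] h(2)] h(1) PM[OF A]
      by (intro N.real_cond_exp_intg(2)) (auto simp: mult.commute)
    also have "\<dots> = (LINT \<omega>:A|M. h \<omega>)" by (simp add: set_lebesgue_integral_def mult.commute)
    also have "\<dots> = (LINT \<omega>:?V B|M. indicator A \<omega>)"
      using hA[OF A] set_integral_indicator[OF VG[OF B] PM[OF A]] by (simp add: Int_commute)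
    finally show "(LINT \<omega>:W|M. indicator A \<omega>) = (LINT \<omega>:W|M. ?fA \<omega>)" unfolding W ..
  qed
  let ?fV = "real_cond_exp M N (indicator (?V B))"
  show ?thesis
  proof (rule P.real_cond_exp_charact)
    show intV: "integrable M (indicator (?V B) :: _ \<Rightarrow> real)" by (rule int[OF V[OF B]])
    then show "integrable M ?fV" by (rule N.real_cond_exp_int)
    show "?fV \<in> borel_measurable P"
      by (rule measurable_from_subalg[OF subalg(2) borel_measurable_cond_exp])
    fix A assume A: "A \<in> sets P"
    let ?fA = "real_cond_exp M N (indicator A)"
    have "(LINT \<omega>:A|M. indicator (?V B) \<omega>) = (LINT \<omega>:?V B|M. indicator A \<omega> :: real)"
      using set_integral_indicator[OF PM[OF A] V[OF B]] set_integral_indicator[OF V[OF B] PM[OF A]]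
      by (simp add: Int_commute)
    also have "\<dots> = (\<integral>\<omega>. ?fA \<omega> * indicator (?V B) \<omega> \<partial>M)"
      unfolding split[OF A B] by (simp add: set_lebesgue_integral_def mult.commute)
    also have "\<dots> = (\<integral>\<omega>. ?fA \<omega> * ?fV \<omega> \<partial>M)"
      using integrable_mult_indicator[OF V[OF B] N.real_cond_exp_int(1)[OF int[OF PM[OF A]]]] V[OF B]
      by (intro N.real_cond_exp_intg(2)[symmetric]) (auto simp: mult.commute)
    also have "\<dots> = (\<integral>\<omega>. ?fV \<omega> * ?fA \<omega> \<partial>M)" by (simp add: mult.commute)
    also have "\<dots> = (\<integral>\<omega>. ?fV \<omega> * indicator A \<omega> \<partial>M)"
      using integrable_mult_indicator[OF PM[OF A] N.real_cond_exp_int(1)[OF intV]] PM[OF A]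
      by (intro N.real_cond_exp_intg(2)) (auto simp: mult.commute)
    finally show "(LINT \<omega>:A|M. indicator (?V B) \<omega>) = (LINT \<omega>:A|M. ?fV \<omega>)"
      by (simp add: set_lebesgue_integral_def mult.commute)
  qed
qed

text \<open>The algebra generated by \<open>H k\<close> only has to contain the past, so its sets
  need not be expressed through \<open>X\<close>. As \<open>g (X k \<omega>)\<close> is measurable
  for the present, matching integrals over \<open>H k\<close> identify it with both conditional
  probabilities.\<close>

lemma markov_processI:
  assumes X: "\<And>k. 1 \<le> k \<Longrightarrow> X k \<in> measurable M S"
    and G: "Int_stable G" "G \<subseteq> Pow (space S)" "sets S = sigma_sets (space S) G"
    and coverG: "CG \<subseteq> G" "countable CG" "\<Union>CG = space S"
    and H: "\<And>k. 1 \<le> k \<Longrightarrow> Int_stable (H k)" "\<And>k. 1 \<le> k \<Longrightarrow> H k \<subseteq> events"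
      "\<And>k. 1 \<le> k \<Longrightarrow> \<exists>C \<subseteq> H k. countable C \<and> \<Union>C = space M"
    and past: "\<And>k j. 1 \<le> j \<Longrightarrow> j \<le> k \<Longrightarrow> X j \<in> measurable (sigma (space M) (H k)) S"
    and step: "\<And>k B. 1 \<le> k \<Longrightarrow> B \<in> G \<Longrightarrow> \<exists>g \<in> borel_measurable S. (\<forall>y. 0 \<le> g y \<and> g y \<le> 1) \<and>
         (\<forall>A \<in> H k. prob (A \<inter> (X (Suc k) -` B \<inter> space M)) = (LINT \<omega>:A|M. g (X k \<omega>)))"
  shows "markov_process M S X"
  unfolding markov_process_def
proof (intro conjI allI impI ballI)
  show "prob_space M" by unfold_locales
  show "X k \<in> measurable M S" if "1 \<le> k" for k using X that .
  fix k B assume k: "1 \<le> (k::nat)" and B: "B \<in> sets S"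
  let ?P = "past_algebra M S X k" and ?N = "present_algebra M S X k"
  have HP: "H k \<subseteq> Pow (space M)" using H(2)[OF k] sets.space_closed by blast
  have sets_H: "sets (sigma (space M) (H k)) = sigma_sets (space M) (H k)" using HP by (rule sets_measure_of)
  have PH: "sets ?P \<subseteq> sigma_sets (space M) (H k)"
    unfolding past_algebra_def sets_H[symmetric]
  proof (rule sets_image_in_sets)
    show "(\<lambda>\<omega>. \<lambda>j\<in>{1..k}. X j \<omega>) \<in> measurable (sigma (space M) (H k)) (Pi\<^sub>M {1..k} (\<lambda>_. S))"
      using past by (intro measurable_restrict) auto
  qed (rule space_measure_of_conv)
  have HM: "sigma_sets (space M) (H k) \<subseteq> events" using H(2)[OF k] by (rule sets.sigma_sets_subset)
  have spP: "space ?P = space M" by (simp add: past_algebra_def)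
  have spN: "space ?N = space M" by (simp add: present_algebra_def)
  have subP: "subalgebra M ?P" using PH HM spP by (auto simp: subalgebra_def)
  have subN: "subalgebra ?P ?N" unfolding subalgebra_def
  proof
    have "(\<lambda>\<omega>. \<lambda>j\<in>{1..k}. X j \<omega>) \<in> measurable ?P (Pi\<^sub>M {1..k} (\<lambda>_. S))"
      unfolding past_algebra_def using measurable_space[OF X]
      by (intro measurable_vimage_algebra1) (auto simp: space_PiM)
    moreover have "(\<lambda>f. f k) \<in> measurable (Pi\<^sub>M {1..k} (\<lambda>_. S)) S"
      using k by (intro measurable_component_singleton) auto
    ultimately have "(\<lambda>\<omega>. (\<lambda>j\<in>{1..k}. X j \<omega>) k) \<in> measurable ?P S"
      by (rule measurable_compose)
    then have "X k \<in> measurable ?P S" using k by simp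
    then show "sets ?N \<subseteq> sets ?P" unfolding present_algebra_def
      by (intro sets_image_in_sets) (simp_all add: spP)
  qed (simp add: spP spN)
  show "AE \<omega> in M. real_cond_exp M ?P (indicator (X (Suc k) -` B \<inter> space M)) \<omega> =
      real_cond_exp M ?N (indicator (X (Suc k) -` B \<inter> space M)) \<omega>"
  proof (rule markov_step_generator[OF subP subN X G coverG _ B])
    fix B assume B: "B \<in> G"
    obtain g where g: "g \<in> borel_measurable S" "\<And>y. 0 \<le> g y" "\<And>y. g y \<le> 1"
      and gA: "\<And>A. A \<in> H k \<Longrightarrow> prob (A \<inter> (X (Suc k) -` B \<inter> space M)) = (LINT \<omega>:A|M. g (X k \<omega>))"
      using step[OF k B] by blast
    have gN: "(\<lambda>\<omega>. g (X k \<omega>)) \<in> borel_measurable ?N"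
      unfolding present_algebra_def using measurable_space[OF X[OF k]]
      by (intro measurable_compose[OF measurable_vimage_algebra1 g(1)]) auto
    have gM: "(\<lambda>\<omega>. g (X k \<omega>)) \<in> borel_measurable M"
      using X[OF k] g(1) by (rule measurable_compose)
    have gint: "integrable M (\<lambda>\<omega>. g (X k \<omega>))"
      using g gM by (intro integrable_const_bound[of _ 1]) auto
    have V: "X (Suc k) -` B \<inter> space M \<in> events"
      using X[of "Suc k"] B G(3) by (intro measurable_sets) auto
    obtain C where C: "C \<subseteq> H k" "countable C" "\<Union>C = space M" using H(3)[OF k] by blast
    have "prob (A \<inter> (X (Suc k) -` B \<inter> space M)) = (LINT \<omega>:A|M. g (X k \<omega>))" if A: "A \<in> sets ?P" for A
    proof -
      have AM: "A \<in> events" and AH: "A \<in> sigma_sets (space M) (H k)" using A PH HM by auto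
      have "(LINT \<omega>:A|M. indicator (X (Suc k) -` B \<inter> space M) \<omega>) = (LINT \<omega>:A|M. g (X k \<omega>))"
      proof (rule set_integral_eq_on_sigma_sets[OF H(1,2)[OF k] C _ _ gint _ _ AH])
        show "integrable M (indicator (X (Suc k) -` B \<inter> space M) :: _ \<Rightarrow> real)"
          using V by (intro integrable_const_bound[of _ 1]) (auto simp: indicator_def)
        show "(LINT \<omega>:A|M. indicator (X (Suc k) -` B \<inter> space M) \<omega>) = (LINT \<omega>:A|M. g (X k \<omega>))" if "A \<in> H k" for A
          using gA[OF that] set_integral_indicator[OF _ V, of A] H(2)[OF k] that by auto
      qed (use g in auto)
      then show ?thesis using set_integral_indicator[OF AM V] by simp
    qed
    then show "\<exists>h. h \<in> borel_measurable ?N \<and> integrable M h \<and>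
         (\<forall>A \<in> sets ?P. prob (A \<inter> (X (Suc k) -` B \<inter> space M)) = (LINT \<omega>:A|M. h \<omega>))"
      using gN gint by blast
  qed simp
qed

end

section \<open>The space of ancestral lines\<close>

instance orient :: countable
  by countable_datatype

text \<open>The shift in \<open>B (Suc n)\<close> is due to entry \<open>n\<close> carrying the
  weights of the crossing at level \<open>n + 1\<close>.\<close>

definition line_box :: "discrete_entry list \<Rightarrow> (nat \<Rightarrow> real list set) \<Rightarrow> line_entry list set" where
  "line_box D B = {l. map discrete_part l = D \<and> (\<forall>n < length D. weight_part (l ! n) \<in> B (Suc n))}"

definition line_boxes :: "line_entry list set set" where
  "line_boxes = {line_box D B |D B. \<forall>n. B n \<in> sets (list_space borel)}"

lemma line_boxI: "(\<And>n. B n \<in> sets (list_space borel)) \<Longrightarrow> line_box D B \<in> line_boxes"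
  by (auto simp: line_boxes_def)

lemma in_listset_iff: "xs \<in> listset As \<longleftrightarrow> length xs = length As \<and> (\<forall>i < length As. xs ! i \<in> As ! i)"
proof (induction As arbitrary: xs)
  case (Cons A As)
  then show ?case by (cases xs) (auto simp: set_Cons_def nth_Cons split: nat.splits)
qed auto

abbreviation line_entry_space :: "line_entry measure" where
  "line_entry_space \<equiv> count_space UNIV \<Otimes>\<^sub>M count_space UNIV \<Otimes>\<^sub>M count_space UNIV \<Otimes>\<^sub>M count_space UNIV \<Otimes>\<^sub>M
      list_space borel"

lemma space_line_entry_space: "space line_entry_space = UNIV"
  by (simp add: space_pair_measure)

lemma space_line_space [simp]: "space line_space = UNIV"
  by (simp add: line_space_def space_line_entry_space)

lemma sets_line_space: "sets line_space = sigma_sets UNIV {listset As |As. set As \<subseteq> sets line_entry_space}"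
  unfolding line_space_def list_space_def[of line_entry_space] by (simp add: space_line_entry_space)

lemma line_box_sets:
  assumes "\<And>n. B n \<in> sets (list_space borel)"
  shows "line_box D B \<in> sets line_space"
proof -
  define C where "C = (\<lambda>n. {e. discrete_part e = D ! n \<and> weight_part e \<in> B (Suc n)})"
  have "C n \<in> sets line_entry_space" for n
  proof -
    obtain \<kappa> S Z A where D: "D ! n = (\<kappa>, S, Z, A)" by (metis prod_cases4)
    have "C n = {\<kappa>} \<times> {S} \<times> {Z} \<times> {A} \<times> B (Suc n)"
      by (auto simp: C_def D weight_part_def)
    then show ?thesis using assms by (simp add: pair_measureI)
  qed
  then have "listset (map C [0..<length D]) \<in> sets line_space"
    unfolding sets_line_space by (intro sigma_sets.Basic CollectI exI[of _ "map C [0..<length D]"]) auto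
  moreover have "listset (map C [0..<length D]) = line_box D B"
  proof (rule Set.set_eqI)
    fix l
    have "map discrete_part l = D \<longleftrightarrow> length l = length D \<and> (\<forall>i < length D. discrete_part (l ! i) = D ! i)"
      by (auto intro: nth_equalityI)
    then show "l \<in> listset (map C [0..<length D]) \<longleftrightarrow> l \<in> line_box D B"
      unfolding in_listset_iff line_box_def C_def by auto
  qed
  ultimately show ?thesis by simp
qed

text \<open>A product set is cut along its countably many discrete parts; on each piece the weights
  range over the sections \<open>B D n\<close>, which are measurable.\<close>

lemma listset_line_boxes:
  assumes As: "set As \<subseteq> sets line_entry_space"
  shows "listset As \<in> sigma_sets UNIV line_boxes"
proof -
  define B where "B = (\<lambda>D n. if 1 \<le> n \<and> n \<le> length As
      then {r. case D ! (n - 1) of (\<kappa>, S, Z, A) \<Rightarrow> (\<kappa>, S, Z, A, r) \<in> As ! (n - 1)} else {})"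
  have B: "B D n \<in> sets (list_space borel)" for D :: "discrete_entry list" and n
  proof (cases "1 \<le> n \<and> n \<le> length As")
    case True
    then have A: "As ! (n - 1) \<in> sets line_entry_space" using As by (auto simp: subset_iff)
    obtain \<kappa> S Z A' where D: "D ! (n - 1) = (\<kappa>, S, Z, A')" by (metis prod_cases4)
    have "{r. (\<kappa>, S, Z, A', r) \<in> As ! (n - 1)} = Pair A' -` (Pair Z -` (Pair S -` (Pair \<kappa> -` (As ! (n - 1)))))"
      by auto
    also have "\<dots> \<in> sets (list_space borel)" by (intro sets_Pair1) (rule A)
    also have "{r. (\<kappa>, S, Z, A', r) \<in> As ! (n - 1)} = B D n"
      using True unfolding B_def D by simp
    finally show ?thesis .
  qed (auto simp: B_def)
  have "listset As = (\<Union>D\<in>{D. length D = length As}. line_box D (B D))"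
  proof -
    have "(case discrete_part e of (\<kappa>, S, Z, A) \<Rightarrow> (\<kappa>, S, Z, A, weight_part e) \<in> X) \<longleftrightarrow> e \<in> X" for e X
      by (cases e) (simp add: weight_part_def)
    then have "l \<in> listset As \<longleftrightarrow> length l = length As \<and> l \<in> line_box (map discrete_part l) (B (map discrete_part l))" for l
      unfolding in_listset_iff line_box_def B_def by auto
    moreover have "l \<in> (\<Union>D\<in>{D. length D = length As}. line_box D (B D)) \<longleftrightarrow>
        length l = length As \<and> l \<in> line_box (map discrete_part l) (B (map discrete_part l))" for l
    proof
      assume "l \<in> (\<Union>D\<in>{D. length D = length As}. line_box D (B D))"
      then obtain D where "length D = length As" "l \<in> line_box D (B D)" by blast
      moreover from this have "D = map discrete_part l" by (simp add: line_box_def)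
      ultimately show "length l = length As \<and> l \<in> line_box (map discrete_part l) (B (map discrete_part l))"
        by simp
    next
      assume l: "length l = length As \<and> l \<in> line_box (map discrete_part l) (B (map discrete_part l))"
      show "l \<in> (\<Union>D\<in>{D. length D = length As}. line_box D (B D))"
        by (rule UN_I[of "map discrete_part l"]) (use l in auto)
    qed
    ultimately show ?thesis by blast
  qed
  also have "\<dots> \<in> sigma_sets UNIV line_boxes"
  proof -
    interpret sigma_algebra UNIV "sigma_sets UNIV line_boxes" by (rule sigma_algebra_sigma_sets) auto
    show ?thesis
      using B by (intro countable_UN'') (auto intro!: sigma_sets.Basic simp: line_boxes_def)
  qed
  finally show ?thesis .
qed

lemma sets_line_space_boxes: "sets line_space = sigma_sets UNIV line_boxes"
proof
  show "sets line_space \<subseteq> sigma_sets UNIV line_boxes"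
    unfolding sets_line_space using listset_line_boxes by (intro sigma_sets_mono) auto
  show "sigma_sets UNIV line_boxes \<subseteq> sets line_space"
    using line_box_sets sets.sigma_sets_subset[of line_boxes line_space] by (auto simp: line_boxes_def)
qed

lemma Int_stable_line_boxes: "Int_stable line_boxes"
proof (rule Int_stableI)
  fix a b assume "a \<in> line_boxes" "b \<in> line_boxes"
  then obtain D B D' B' where a: "a = line_box D B" "\<And>n. B n \<in> sets (list_space borel)"
    and b: "b = line_box D' B'" "\<And>n. B' n \<in> sets (list_space borel)"
    by (auto simp: line_boxes_def)
  show "a \<inter> b \<in> line_boxes"
  proof (cases "D = D'")
    case True
    then have "a \<inter> b = line_box D (\<lambda>n. B n \<inter> B' n)" unfolding a b line_box_def by auto
    then show ?thesis using a(2) b(2) by (simp add: line_boxI)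
  next
    case False
    \<comment> \<open>The empty set is a box only if there is an entry for the empty weight set to
      constrain, hence the one-element list.\<close>
    have "a \<inter> b = line_box [(0, 0, 0, [])] (\<lambda>_. {})" using False unfolding a b line_box_def by auto
    then show ?thesis by (simp add: line_boxI)
  qed
qed

lemma UNIV_sets_list_space: "UNIV \<in> sets (list_space borel :: real list measure)"
  using sets.top[of "list_space borel :: real list measure"] by simp

lemma line_boxes_cover:
  "range (\<lambda>D. line_box D (\<lambda>_. UNIV)) \<subseteq> line_boxes" "countable (range (\<lambda>D. line_box D (\<lambda>_. UNIV)))"
  "\<Union> (range (\<lambda>D. line_box D (\<lambda>_. UNIV))) = UNIV"
proof -
  show "range (\<lambda>D. line_box D (\<lambda>_. UNIV)) \<subseteq> line_boxes"
    by (intro image_subsetI line_boxI UNIV_sets_list_space)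
  show "\<Union> (range (\<lambda>D. line_box D (\<lambda>_. UNIV))) = UNIV"
    by (auto simp: line_box_def)
qed simp

lemma measurable_discrete_parts: "map discrete_part \<in> measurable line_space (count_space UNIV)"
  unfolding measurable_count_space_eq2_countable
proof (intro conjI ballI)
  fix D
  have "map discrete_part -` {D} \<inter> space line_space = line_box D (\<lambda>_. UNIV)"
    by (auto simp: line_box_def)
  then show "map discrete_part -` {D} \<inter> space line_space \<in> sets line_space"
    using line_box_sets[OF UNIV_sets_list_space] by simp
qed simp

text \<open>Spreads the constraints of a line over all nodes of a past, so that they can be
  intersected with the weight sets of a cylinder.\<close>

definition index_constraint :: "discrete_entry list \<Rightarrow> (nat \<Rightarrow> real list set) \<Rightarrow> nat \<Rightarrow> nat \<Rightarrow> real list set" where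
  "index_constraint D B n i = (if 1 \<le> n \<and> n \<le> length D \<and> i = entry_index D n then B n else UNIV)"

lemma index_constraint_sets:
  "(\<And>n. B n \<in> sets (list_space borel)) \<Longrightarrow> index_constraint D B n i \<in> sets (list_space borel)"
  using UNIV_sets_list_space by (simp add: index_constraint_def)

text \<open>Since the past grows with time, constraints on any earlier line \<open>j\<close> can be
  stated on the index set of time \<open>k\<close>.\<close>

lemma ancestral_line_in_box_iff:
  assumes path: "crossing_path (\<lambda>t. Y t \<omega>)" and k: "1 \<le> j" "j \<le> k"
  defines "a \<equiv> path_forest (\<lambda>t. Y t \<omega>)"
  shows "ancestral_line Y R j \<omega> \<in> line_box D B \<longleftrightarrow>
    discrete_line a j = D \<and> (\<forall>(n, i) \<in> past_nodes a k. R (int n) i \<omega> \<in> index_constraint D B n i)"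
proof -
  note al = ancestral_line_eq[where Y = Y and \<omega> = \<omega> and k = j and R = R, OF path k(1), folded a_def]
  have a: "branching a" unfolding a_def using crossing_path.branching_path_forest[OF path] .
  have "(\<forall>n < Suc (top_level a j). R (int (Suc n)) (line a (Suc n) j) \<omega> \<in> B (Suc n)) \<longleftrightarrow>
      (\<forall>(n, i) \<in> past_nodes a k. R (int n) i \<omega> \<in> index_constraint (discrete_line a j) B n i)" (is "?L \<longleftrightarrow> ?R")
  proof
    assume L: ?L
    show ?R
    proof clarify
      fix n i assume "(n, i) \<in> past_nodes a k"
      then show "R (int n) i \<omega> \<in> index_constraint (discrete_line a j) B n i"
        using L[rule_format, of "n - 1"] by (auto simp: index_constraint_def entry_index_discrete_line[OF a k(1)] simp del: line.simps)
    qed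
  next
    assume R: ?R
    show ?L
    proof clarify
      fix n assume n: "n < Suc (top_level a j)"
      have "(Suc n, line a (Suc n) j) \<in> past_nodes a j"
        using n line_pos[OF a k(1), of "Suc n"] by (auto simp: past_nodes_def)
      then have "(Suc n, line a (Suc n) j) \<in> past_nodes a k" using past_nodes_mono[OF a k] by blast
      then show "R (int (Suc n)) (line a (Suc n) j) \<omega> \<in> B (Suc n)"
        using bspec[OF R, of "(Suc n, line a (Suc n) j)"] n
        by (auto simp: index_constraint_def entry_index_discrete_line[OF a k(1)] simp del: line.simps split: if_splits)
    qed
  qed
  then show ?thesis unfolding line_box_def using al by (auto simp del: line.simps)
qed

section \<open>Transition probabilities of the ancestral line\<close>

text \<open>The part of the constraint on the next line that concerns crossings already on the
  current line; it can be checked on the current line.\<close>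

definition retained :: "discrete_entry list \<Rightarrow> discrete_entry list \<Rightarrow> (nat \<Rightarrow> real list set) \<Rightarrow> nat \<Rightarrow> real list set" where
  "retained d D B n = (if 1 \<le> n \<and> n \<le> length D \<and> n \<notin> fresh_levels d D then B n else UNIV)"

lemma retained_sets: "(\<And>n. B n \<in> sets (list_space borel)) \<Longrightarrow> retained d D B n \<in> sets (list_space borel)"
  using UNIV_sets_list_space by (simp add: retained_def)

lemma length_discrete_line_Suc:
  assumes "branching a" "1 \<le> k"
  shows "length (discrete_line a (Suc k)) = length (discrete_line a k) \<or>
    length (discrete_line a (Suc k)) = Suc (length (discrete_line a k))"
  using top_level_Suc_le[OF assms] top_level_mono[OF assms, of "Suc k"] by auto

text \<open>At a fresh level the next line lies just to the right of the current one and constrains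
  no old node; at any other level the two indices coincide.\<close>

lemma index_constraint_retained:
  assumes b: "branching b" and k: "1 \<le> k"
    and d: "d = discrete_line b k" and D: "D = discrete_line b (Suc k)"
    and n: "1 \<le> n" "n \<le> length d" "i \<le> entry_index d n"
  shows "index_constraint D B n i = index_constraint d (retained d D B) n i"
proof -
  have "length d \<le> length D" using length_discrete_line_Suc[OF b k] unfolding d D by auto
  moreover have "entry_index D n = entry_index d n \<or> entry_index D n = Suc (entry_index d n)"
    using line_Suc_cases[OF b k, of n] k unfolding d D by (simp add: entry_index_discrete_line[OF b])
  ultimately show ?thesis
    using n by (auto simp: index_constraint_def retained_def fresh_levels_def)
qed

definition kept_weights :: "discrete_entry list \<Rightarrow> discrete_entry list \<Rightarrow> (nat \<Rightarrow> real list set)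
    \<Rightarrow> (nat \<Rightarrow> nat \<Rightarrow> real list set) \<Rightarrow> nat \<Rightarrow> nat \<Rightarrow> real list set" where
  "kept_weights d D B C n i = C n i \<inter> index_constraint d (retained d D B) n i"

context mebp_process
begin

text \<open>The type of the crossing is computable from \<open>D\<close>: its parent lies on
  \<open>D\<close> too, and the top crossing shows its type as the last entry of its own
  vector.\<close>

definition fresh_weight :: "discrete_entry list \<Rightarrow> (nat \<Rightarrow> real list set) \<Rightarrow> nat \<Rightarrow> real" where
  "fresh_weight D B n = mark_prob (if n = length D then last (entry_children D n)
     else entry_children D (Suc n) ! (entry_pos D n - 1)) (entry_children D n) (B n)"

text \<open>
  Where \<open>root_prob (length d) _\<close> is 0, the past ending in \<open>d\<close> has probability 0, and the value 0 of the
  quotient is harmless.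
\<close>

definition root_ratio :: "discrete_entry list \<Rightarrow> discrete_entry list \<Rightarrow> real" where
  "root_ratio d D = (if length D = length d then 1
     else if entry_children D (length D) ! 0 = last (entry_children d (length d))
     then root_prob (length D) (last (entry_children D (length D))) /
       root_prob (length d) (last (entry_children d (length d)))
     else 0)"

definition step_prob :: "discrete_entry list \<Rightarrow> discrete_entry list \<Rightarrow> (nat \<Rightarrow> real list set) \<Rightarrow> real" where
  "step_prob d D B = root_ratio d D * (\<Prod>n\<in>fresh_levels d D. fresh_weight D B n)"

lemma step_prob_nonneg: "0 \<le> step_prob d D B"
proof -
  have "0 \<le> root_ratio d D" by (simp add: root_ratio_def root_prob_def)
  moreover have "0 \<le> fresh_weight D B n" for n by (simp add: fresh_weight_def mark_prob_def)
  ultimately show ?thesis unfolding step_prob_def by (intro mult_nonneg_nonneg prod_nonneg) auto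
qed

lemma cylinder_mono:
  "(\<And>n i. (n, i) \<in> I \<Longrightarrow> (n, i) \<in> J \<and> a n i = b n i \<and> C n i \<subseteq> B n i) \<Longrightarrow> cylinder J b C \<subseteq> cylinder I a B"
  unfolding cylinder_def by fastforce

lemma cylinder_iff:
  "\<omega> \<in> cylinder (past_nodes a k) a C \<longleftrightarrow>
     \<omega> \<in> space M \<and> agree a k (forest \<omega>) \<and> (\<forall>(n, i) \<in> past_nodes a k. R (int n) i \<omega> \<in> C n i)"
  by (auto simp: cylinder_def agree_def)

lemma ancestral_line_in_box:
  assumes "\<omega> \<in> space M" "1 \<le> j" "j \<le> k"
  shows "ancestral_line Y R j \<omega> \<in> line_box D B \<longleftrightarrow> discrete_line (forest \<omega>) j = D \<and>
    (\<forall>(n, i) \<in> past_nodes (forest \<omega>) k. R (int n) i \<omega> \<in> index_constraint D B n i)"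
  using crossing_path[OF assms(1)] assms(2,3) by (rule ancestral_line_in_box_iff)

lemma discrete_parts_ancestral_line:
  assumes "\<omega> \<in> space M" "1 \<le> k"
  shows "map discrete_part (ancestral_line Y R k \<omega>) = discrete_line (forest \<omega>) k"
  using crossing_path[OF assms(1)] assms(2) by (rule ancestral_line_eq)

lemma cylinder_Int_box:
  assumes a: "branching a" and k: "1 \<le> j" "j \<le> k"
  shows "cylinder (past_nodes a k) a C \<inter> (ancestral_line Y R j -` line_box D B \<inter> space M) =
    (if discrete_line a j = D then cylinder (past_nodes a k) a (\<lambda>n i. C n i \<inter> index_constraint D B n i) else {})"
proof -
  have k': "1 \<le> k" using k by simp
  have "ancestral_line Y R j \<omega> \<in> line_box D B \<longleftrightarrow>
     discrete_line a j = D \<and> (\<forall>(n, i) \<in> past_nodes a k. R (int n) i \<omega> \<in> index_constraint D B n i)"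
    if "\<omega> \<in> cylinder (past_nodes a k) a C" for \<omega>
  proof -
    have sp: "\<omega> \<in> space M" and ag: "agree a k (forest \<omega>)" using that by (auto simp: cylinder_iff)
    note f = branching_forest[OF sp]
    show ?thesis
      using ancestral_line_in_box[OF sp k, of D B]
        agree_discrete_line[OF a f ag k] agree_past_nodes[OF a f ag k' k' order.refl] by simp
  qed
  moreover have "\<omega> \<in> space M" if "\<omega> \<in> cylinder (past_nodes a k) a C" for \<omega> using that by (simp add: cylinder_iff)
  moreover have "\<omega> \<in> cylinder (past_nodes a k) a (\<lambda>n i. C n i \<inter> index_constraint D B n i) \<longleftrightarrow>
     \<omega> \<in> cylinder (past_nodes a k) a C \<and> (\<forall>(n, i) \<in> past_nodes a k. R (int n) i \<omega> \<in> index_constraint D B n i)" for \<omega>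
    unfolding cylinder_iff by blast
  ultimately show ?thesis by auto
qed

section \<open>A single transition between two fixed discrete lines\<close>

context
  fixes a b :: forest and k :: nat and d D :: "discrete_entry list"
    and B :: "nat \<Rightarrow> real list set" and C :: "nat \<Rightarrow> nat \<Rightarrow> real list set"
  assumes a: "branching a" and b: "branching b" and k: "1 \<le> k"
    and d: "discrete_line a k = d" and eq: "discrete_line b k = d" and D: "discrete_line b (Suc k) = D"
    and B: "\<And>n. B n \<in> sets (list_space borel)" and C: "\<And>n i. C n i \<in> sets (list_space borel)"
begin

definition "extension = merge a b k"
definition "next_weights n i = (if (n, i) \<in> past_nodes a k then C n i else UNIV) \<inter> index_constraint D B n i"

lemma eq_ab: "discrete_line a k = discrete_line b k" using d eq by simp

lemma branching_m: "branching extension" unfolding extension_def by (rule branching_merge[OF a b k eq_ab])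

lemma discrete_line_m: "discrete_line extension k = d" "discrete_line extension (Suc k) = D"
  unfolding extension_def using discrete_line_merge[OF a b k eq_ab] discrete_line_merge_Suc[OF a b k eq_ab] d D by auto

lemma past_nodes_m: "past_nodes extension k = past_nodes a k"
  unfolding extension_def using agree_past_nodes[OF a branching_merge[OF a b k eq_ab] agree_merge[OF a b k eq_ab] k k order.refl] .

lemma m_past: "(n, i) \<in> past_nodes a k \<Longrightarrow> extension n i = a n i" by (simp add: extension_def merge_def)

lemma past_nodes_m_Suc:
  "past_nodes extension (Suc k) = past_nodes a k \<union> (\<lambda>n. (n, line extension n (Suc k))) ` fresh_levels d D"
  "past_nodes a k \<inter> (\<lambda>n. (n, line extension n (Suc k))) ` fresh_levels d D = {}"
  using past_nodes_Suc[OF branching_m b k] past_nodes_fresh_disjoint[OF branching_m b k] past_nodes_m discrete_line_m eq by auto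

lemma length_d: "length d = Suc (top_level a k)" using d by auto
lemma length_D: "length D = Suc (top_level extension (Suc k))" using discrete_line_m by auto
lemma length_D_cases: "length D = length d \<or> length D = Suc (length d)"
  using length_discrete_line_Suc[OF b k] eq D by simp

lemma next_weights_sets: "next_weights n i \<in> sets (list_space borel)"
  unfolding next_weights_def by (intro sets.Int index_constraint_sets B) (auto intro: C UNIV_sets_list_space)

lemma kept_weights_sets: "kept_weights d D B C n i \<in> sets (list_space borel)"
  unfolding kept_weights_def by (intro sets.Int index_constraint_sets retained_sets B C)

lemma next_weights_past: "(n, i) \<in> past_nodes a k \<Longrightarrow> next_weights n i = kept_weights d D B C n i"
  using index_constraint_retained[OF b k eq[symmetric] D[symmetric], of n i B] length_d
    entry_index_discrete_line[OF a k, of n] d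
  by (auto simp: next_weights_def kept_weights_def past_nodes_def)

text \<open>By \<open>agree_merge_Suc_iff\<close> the joint event is a cylinder of the merged
  forest, so the product formula covers it as well.\<close>

lemma cylinder_Int_next_box:
  "cylinder (past_nodes a k) a C \<inter> (ancestral_line Y R (Suc k) -` line_box D B \<inter> space M) =
    cylinder (past_nodes extension (Suc k)) extension next_weights" (is "?E \<inter> ?V = ?F")
proof (rule Set.set_eqI)
  fix \<omega>
  show "\<omega> \<in> ?E \<inter> ?V \<longleftrightarrow> \<omega> \<in> ?F"
  proof (cases "\<omega> \<in> space M")
    case sp: True
    note f = branching_forest[OF sp]
    have ag: "agree extension (Suc k) (forest \<omega>) \<longleftrightarrow> agree a k (forest \<omega>) \<and> discrete_line (forest \<omega>) (Suc k) = D"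
      unfolding extension_def using agree_merge_Suc_iff[OF a b k eq_ab f] D by simp
    have pn: "past_nodes (forest \<omega>) (Suc k) = past_nodes extension (Suc k)" if "agree extension (Suc k) (forest \<omega>)"
      using agree_past_nodes[OF branching_m f that] by simp
    have "\<omega> \<in> ?V \<longleftrightarrow> discrete_line (forest \<omega>) (Suc k) = D \<and>
        (\<forall>(n, i) \<in> past_nodes (forest \<omega>) (Suc k). R (int n) i \<omega> \<in> index_constraint D B n i)"
      using ancestral_line_in_box[OF sp, of "Suc k" "Suc k" D B] sp by simp
    moreover have "(\<forall>(n, i) \<in> past_nodes extension (Suc k). R (int n) i \<omega> \<in> next_weights n i) \<longleftrightarrow>
      (\<forall>(n, i) \<in> past_nodes a k. R (int n) i \<omega> \<in> C n i) \<and>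
      (\<forall>(n, i) \<in> past_nodes extension (Suc k). R (int n) i \<omega> \<in> index_constraint D B n i)"
      using past_nodes_m_Suc(1) unfolding next_weights_def by auto
    ultimately show ?thesis unfolding Int_iff cylinder_iff using ag pn sp by auto
  qed (simp add: cylinder_iff)
qed

text \<open>Settles the degenerate cases: a past whose root type has probability 0, and later a
  formal transition value above 1.\<close>

lemma prob_next_box_le:
  "prob (cylinder (past_nodes a k) a C \<inter> (ancestral_line Y R (Suc k) -` line_box D B \<inter> space M))
    \<le> prob (cylinder (past_nodes a k) a (kept_weights d D B C))"
  unfolding cylinder_Int_next_box
proof (rule finite_measure_mono)
  show "cylinder (past_nodes a k) a (kept_weights d D B C) \<in> events"
    by (intro cylinder_sets[OF a ancestor_closed_past_nodes[OF a k]] kept_weights_sets)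
  show "cylinder (past_nodes extension (Suc k)) extension next_weights \<subseteq> cylinder (past_nodes a k) a (kept_weights d D B C)"
    using past_nodes_m_Suc(1) m_past next_weights_past by (intro cylinder_mono) auto
qed

abbreviation "weight_a z \<equiv> (case z of (n, i) \<Rightarrow>
    mark_prob (if n = length d then last (a (length d) 1) else node_type a n i) (a n i) (kept_weights d D B C n i))"
abbreviation "weight_m z \<equiv> (case z of (n, i) \<Rightarrow>
    mark_prob (if n = length D then last (extension (length D) 1) else node_type extension n i) (extension n i) (next_weights n i))"

lemma prob_past: "prob (cylinder (past_nodes a k) a (kept_weights d D B C)) =
    root_prob (length d) (last (a (length d) 1)) * (\<Prod>z \<in> past_nodes a k. weight_a z)"
  unfolding length_d by (rule cylinder_prob[OF a ancestor_closed_past_nodes[OF a k] kept_weights_sets])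

lemma weight_m_fresh:
  assumes n: "n \<in> fresh_levels d D"
  shows "weight_m (n, line extension n (Suc k)) = fresh_weight D B n"
proof -
  let ?i = "line extension n (Suc k)"
  have n': "1 \<le> n" "n \<le> length D" using n by (auto simp: fresh_levels_def)
  have "(n, ?i) \<notin> past_nodes a k" using past_nodes_m_Suc(2) n by blast
  moreover have "entry_index D n = ?i"
    using entry_index_discrete_line[OF branching_m, of "Suc k" n] discrete_line_m by simp
  ultimately have "next_weights n ?i = B n" using n' by (simp add: next_weights_def index_constraint_def)
  moreover have ch: "entry_children D l = extension l (line extension l (Suc k))" if "1 \<le> l" "l \<le> length D" for l
    using entry_children_discrete_line[OF that(1), of extension "Suc k"] that(2) discrete_line_m length_D by simp
  moreover have "node_type extension n ?i = entry_children D (Suc n) ! (entry_pos D n - 1)" if "n \<noteq> length D"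
    using that n' ch[of "Suc n"] entry_pos_discrete_line[of n extension "Suc k"] discrete_line_m length_D
    by (simp add: node_type_def)
  moreover have "line extension (length D) (Suc k) = 1"
    unfolding length_D using line_top[OF branching_m, of "Suc k"] by simp
  ultimately show ?thesis using n' ch[of "length D"] by (auto simp: fresh_weight_def)
qed

lemma prob_next: "prob (cylinder (past_nodes extension (Suc k)) extension next_weights) =
    root_prob (length D) (last (entry_children D (length D))) *
      ((\<Prod>z \<in> past_nodes a k. weight_m z) * (\<Prod>n\<in>fresh_levels d D. fresh_weight D B n))"
proof -
  have fin: "finite (fresh_levels d D)"
    by (rule finite_subset[of _ "{..length D}"]) (auto simp: fresh_levels_def)
  have inj: "inj_on (\<lambda>n. (n, line extension n (Suc k))) (fresh_levels d D)" by (auto simp: inj_on_def)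
  have root: "entry_children D (length D) = extension (length D) 1"
    using entry_children_discrete_line[of "length D" extension "Suc k"] discrete_line_m length_D
      line_top[OF branching_m, of "Suc k"] by simp
  have "prob (cylinder (past_nodes extension (Suc k)) extension next_weights) = root_prob (length D) (last (extension (length D) 1)) *
     (\<Prod>z \<in> past_nodes extension (Suc k). weight_m z)"
    unfolding length_D
    by (rule cylinder_prob[OF branching_m ancestor_closed_past_nodes[OF branching_m] next_weights_sets]) simp
  also have "(\<Prod>z \<in> past_nodes extension (Suc k). weight_m z) = (\<Prod>z \<in> past_nodes a k. weight_m z) *
      (\<Prod>z \<in> (\<lambda>n. (n, line extension n (Suc k))) ` fresh_levels d D. weight_m z)"
    unfolding past_nodes_m_Suc(1) using finite_past_nodes[OF a] fin past_nodes_m_Suc(2)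
    by (intro prod.union_disjoint) auto
  also have "(\<Prod>z \<in> (\<lambda>n. (n, line extension n (Suc k))) ` fresh_levels d D. weight_m z) =
      (\<Prod>n\<in>fresh_levels d D. fresh_weight D B n)"
    unfolding prod.reindex[OF inj] comp_def using weight_m_fresh by (intro prod.cong) auto
  finally show ?thesis unfolding root .
qed

text \<open>The old root is excluded because its parent need not belong to the past of
  \<open>a\<close>; \<open>prob_next_box\<close> treats its type separately.\<close>

lemma node_type_m: "(n, i) \<in> past_nodes a k \<Longrightarrow> n \<noteq> length d \<Longrightarrow> node_type extension n i = node_type a n i"
  using agree_node_type[OF a branching_m _ k, of n i] agree_merge[OF a b k eq_ab]
  by (auto simp: extension_def past_nodes_def length_d)

lemma root_past: "(length d, 1) \<in> past_nodes a k" "(length d, i) \<in> past_nodes a k \<Longrightarrow> i = 1"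
  using ancestor_closed_past_nodes[OF a k] unfolding length_d[symmetric] ancestor_closed_def by auto

lemma prob_next_box:
  "prob (cylinder (past_nodes a k) a C \<inter> (ancestral_line Y R (Suc k) -` line_box D B \<inter> space M)) =
    step_prob d D B * prob (cylinder (past_nodes a k) a (kept_weights d D B C))"
proof -
  let ?t = "last (a (length d) 1)" and ?Q = "\<Prod>n\<in>fresh_levels d D. fresh_weight D B n"
  have t: "entry_children d (length d) = a (length d) 1"
    using entry_children_discrete_line[of "length d" a k] d length_d line_top[OF a k] by simp
  show ?thesis
  proof (cases "length D = length d")
    case True
    have "weight_m z = weight_a z" if "z \<in> past_nodes a k" for z
      using that m_past next_weights_past node_type_m m_past[OF root_past(1)] True by (cases z) auto
    then have "(\<Prod>z \<in> past_nodes a k. weight_m z) = (\<Prod>z \<in> past_nodes a k. weight_a z)"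
      by (intro prod.cong) auto
    moreover have "entry_children D (length D) = a (length d) 1"
      using entry_children_discrete_line[of "length D" extension "Suc k"] discrete_line_m length_D
        line_top[OF branching_m, of "Suc k"] m_past[OF root_past(1)] True by simp
    ultimately show ?thesis
      unfolding cylinder_Int_next_box prob_next prob_past step_prob_def root_ratio_def using True by simp
  next
    case False
    then have L: "length D = Suc (length d)" using length_D_cases by simp
    let ?h = "entry_children D (length D) ! 0"
    \<comment> \<open>The old root is the first child of the new one, so the first entry of the new
      root's vector is now its type.\<close>
    have h: "node_type extension (length d) 1 = ?h"
    proof -
      have "entry_children D (length D) = extension (Suc (length d)) 1"
        using entry_children_discrete_line[of "length D" extension "Suc k"] discrete_line_m length_D
          line_top[OF branching_m, of "Suc k"] L by simp
      then show ?thesis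
        using parent_1[OF branching_m, of "Suc (length d)"] by (simp add: node_type_def sibling_pos_def)
    qed
    show ?thesis
    proof (cases "?h = ?t")
      case True
      have "weight_m z = weight_a z" if "z \<in> past_nodes a k" for z
      proof -
        obtain n i where z: "z = (n, i)" by force
        have "n \<le> length d" using that by (auto simp: z past_nodes_def length_d)
        then show ?thesis
          using that m_past next_weights_past node_type_m[of n i] root_past(2)[of i] h True L unfolding z
          by (cases "n = length d") auto
      qed
      then have P: "(\<Prod>z \<in> past_nodes a k. weight_m z) = (\<Prod>z \<in> past_nodes a k. weight_a z)"
        by (intro prod.cong) auto
      show ?thesis
      proof (cases "root_prob (length d) ?t = 0")
        case True
        then show ?thesis using prob_next_box_le prob_past by (simp add: measure_le_0_iff)
      next
        case False
        then show ?thesis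
          unfolding cylinder_Int_next_box prob_next prob_past step_prob_def root_ratio_def P
          using True L t by simp
      qed
    next
      case False
      \<comment> \<open>The old root's vector ends in \<open>?t\<close>, but the new root assigns it
        the type \<open>?h\<close>; the corresponding factor vanishes.\<close>
      have zero: "weight_m (length d, 1) = 0"
        using mark_prob_last[of ?h "a (length d) 1"] False h L m_past[OF root_past(1)] by auto
      have "(\<Prod>z \<in> past_nodes a k. weight_m z) = 0"
        using finite_past_nodes[OF a] bexI[of "\<lambda>z. weight_m z = 0", OF zero root_past(1)] by (rule prod_zero)
      then show ?thesis
        unfolding cylinder_Int_next_box prob_next step_prob_def root_ratio_def using False L t by simp
    qed
  qed
qed

end

section \<open>A generator for the past, and the Markov property\<close>

definition past_cylinders :: "nat \<Rightarrow> 'w set set" where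
  "past_cylinders k = {cylinder (past_nodes a k) a C |a C. branching a \<and> (\<forall>n i. C n i \<in> sets (list_space borel))}"

lemma sets_past_cylinders: "sets (sigma (space M) (past_cylinders k)) = sigma_sets (space M) (past_cylinders k)"
  by (rule sets_measure_of) (auto simp: past_cylinders_def cylinder_def)

lemma past_cylinders_events:
  assumes "1 \<le> k"
  shows "past_cylinders k \<subseteq> events"
  using cylinder_sets[OF _ ancestor_closed_past_nodes[OF _ assms]] by (auto simp: past_cylinders_def)

text \<open>A common point forces both cylinders to prescribe the same past; only the weight sets
  remain to be intersected.\<close>

lemma Int_stable_past_cylinders:
  assumes k: "1 \<le> k"
  shows "Int_stable (past_cylinders k)"
proof (rule Int_stableI)
  fix A A' assume "A \<in> past_cylinders k" "A' \<in> past_cylinders k"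
  then obtain a C a' C' where a: "A = cylinder (past_nodes a k) a C" "branching a" "\<And>n i. C n i \<in> sets (list_space borel)"
    and a': "A' = cylinder (past_nodes a' k) a' C'" "branching a'" "\<And>n i. C' n i \<in> sets (list_space borel)"
    by (auto simp: past_cylinders_def)
  show "A \<inter> A' \<in> past_cylinders k"
  proof (cases "A \<inter> A' = {}")
    case True
    have "(Suc (top_level a k), 1) \<in> past_nodes a k"
      using ancestor_closed_past_nodes[OF a(2) k] by (simp add: ancestor_closed_def)
    \<comment> \<open>The past contains its root, so empty weight sets do give the empty
      set.\<close>
    then have "A \<inter> A' = cylinder (past_nodes a k) a (\<lambda>_ _. {})"
      using True by (auto simp: cylinder_def)
    then show ?thesis unfolding past_cylinders_def using a(2) by blast
  next
    case False
    then obtain \<omega> where w: "\<omega> \<in> space M" "agree a k (forest \<omega>)" "agree a' k (forest \<omega>)"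
      unfolding a(1) a'(1) by (auto simp: cylinder_iff)
    note f = branching_forest[OF w(1)]
    have eq: "past_nodes a k = past_nodes a' k"
      using agree_past_nodes[OF a(2) f w(2) k k order.refl] agree_past_nodes[OF a'(2) f w(3) k k order.refl] by simp
    have "forest \<omega> n i = a n i" "forest \<omega> n i = a' n i" if "(n, i) \<in> past_nodes a k" for n i
      using w(2,3) that eq unfolding agree_def by blast+
    then have "a n i = a' n i" if "(n, i) \<in> past_nodes a k" for n i
      using that by metis
    then have "A \<inter> A' = cylinder (past_nodes a k) a (\<lambda>n i. C n i \<inter> C' n i)"
      unfolding a(1) a'(1) eq by (fastforce simp: cylinder_def)
    moreover have "\<forall>n i. C n i \<inter> C' n i \<in> sets (list_space borel)" using a(3) a'(3) by blast
    ultimately show ?thesis unfolding past_cylinders_def using a(2) by blast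
  qed
qed

text \<open>There are uncountably many forests, but a cylinder with fixed weight sets depends only
  on the finite graph of \<open>a\<close> over its past.\<close>

lemma countable_cylinders: "countable {cylinder (past_nodes a k) a C |a. branching a \<and> P a}"
proof -
  define cyl where "cyl = (\<lambda>s. {\<omega> \<in> space M. \<forall>(n, i, x) \<in> s. forest \<omega> n i = x \<and> R (int n) i \<omega> \<in> C n i})"
  define graph where "graph = (\<lambda>a::forest. (\<lambda>(n, i). (n, i, a n i)) ` past_nodes a k)"
  have "{cylinder (past_nodes a k) a C |a. branching a \<and> P a} \<subseteq> cyl ` Collect finite"
  proof clarify
    fix a assume "branching a"
    then have "finite (graph a)" using finite_past_nodes by (simp add: graph_def)
    moreover have "cylinder (past_nodes a k) a C = cyl (graph a)"
      by (auto simp: cylinder_def cyl_def graph_def)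
    ultimately show "cylinder (past_nodes a k) a C \<in> cyl ` Collect finite" by blast
  qed
  moreover have "countable (Collect finite :: (nat \<times> nat \<times> orient list) set set)"
    by (rule countable_Collect_finite)
  ultimately show ?thesis by (rule countable_subset[OF _ countable_image])
qed

lemma past_cylinders_cover:
  "\<exists>Q \<subseteq> past_cylinders k. countable Q \<and> \<Union>Q = space M"
proof (intro exI conjI)
  let ?Q = "{cylinder (past_nodes a k) a (\<lambda>_ _. UNIV) |a. branching a \<and> True}"
  show "countable ?Q" by (rule countable_cylinders)
  show "?Q \<subseteq> past_cylinders k" using UNIV_sets_list_space by (auto simp: past_cylinders_def)
  have "\<omega> \<in> cylinder (past_nodes (forest \<omega>) k) (forest \<omega>) (\<lambda>_ _. UNIV)" if "\<omega> \<in> space M" for \<omega>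
    using that by (auto simp: cylinder_def)
  moreover have "cylinder (past_nodes (forest \<omega>) k) (forest \<omega>) (\<lambda>_ _. UNIV) \<in> ?Q" if "\<omega> \<in> space M" for \<omega>
    using branching_forest[OF that] by blast
  ultimately have "space M \<subseteq> \<Union>?Q" by (meson UnionI subsetI)
  moreover have "\<Union>?Q \<subseteq> space M" by (auto simp: cylinder_iff)
  ultimately show "\<Union>?Q = space M" by (rule equalityI[rotated])
qed

text \<open>The line is a different function of the marks on each possible past, so the preimage of
  a box is taken apart into countably many cylinders.\<close>

lemma ancestral_line_measurable_past:
  assumes k: "1 \<le> j" "j \<le> k"
  shows "ancestral_line Y R j \<in> measurable (sigma (space M) (past_cylinders k)) line_space"
proof (rule measurable_sigma_sets[OF sets_line_space_boxes])
  let ?S = "sigma (space M) (past_cylinders k)"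
  have sp: "space ?S = space M" by (rule space_measure_of_conv)
  fix W assume "W \<in> line_boxes"
  then obtain D B where W: "W = line_box D B" and B: "\<And>n. B n \<in> sets (list_space borel)"
    by (auto simp: line_boxes_def)
  let ?Q = "{cylinder (past_nodes a k) a (index_constraint D B) |a. branching a \<and> discrete_line a j = D}"
  have "ancestral_line Y R j -` W \<inter> space M = \<Union>?Q"
  proof
    show "ancestral_line Y R j -` W \<inter> space M \<subseteq> \<Union>?Q"
    proof
      fix \<omega> assume w: "\<omega> \<in> ancestral_line Y R j -` W \<inter> space M"
      then have "discrete_line (forest \<omega>) j = D"
        "\<forall>(n, i) \<in> past_nodes (forest \<omega>) k. R (int n) i \<omega> \<in> index_constraint D B n i"
        using ancestral_line_in_box[OF _ k, of \<omega> D B] by (auto simp: W)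
      then have "\<omega> \<in> cylinder (past_nodes (forest \<omega>) k) (forest \<omega>) (index_constraint D B)"
        using w by (auto simp: cylinder_def)
      then show "\<omega> \<in> \<Union>?Q" using branching_forest[of \<omega>] w \<open>discrete_line (forest \<omega>) j = D\<close> by blast
    qed
    show "\<Union>?Q \<subseteq> ancestral_line Y R j -` W \<inter> space M"
    proof
      fix \<omega> assume "\<omega> \<in> \<Union>?Q"
      then obtain a where a: "branching a" "discrete_line a j = D" "\<omega> \<in> cylinder (past_nodes a k) a (index_constraint D B)"
        by blast
      then show "\<omega> \<in> ancestral_line Y R j -` W \<inter> space M"
        using cylinder_Int_box[OF a(1) k, of "index_constraint D B" D B] by (auto simp: W)
    qed
  qed
  also have "\<dots> \<in> sets ?S"
  proof (rule sets.countable_Union)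
    show "countable ?Q" by (rule countable_cylinders)
    show "?Q \<subseteq> sets ?S"
    proof -
      have "\<forall>n i. index_constraint D B n i \<in> sets (list_space borel)"
        using index_constraint_sets[of B] B by blast
      then have "?Q \<subseteq> past_cylinders k" unfolding past_cylinders_def by blast
      then show ?thesis unfolding sets_past_cylinders by (blast intro: sigma_sets.Basic)
    qed
  qed
  finally show "ancestral_line Y R j -` W \<inter> space ?S \<in> sets ?S" unfolding sp .
qed auto

lemma ancestral_line_step:
  assumes k: "1 \<le> k" and W: "W \<in> line_boxes"
  shows "\<exists>g \<in> borel_measurable line_space. (\<forall>y. 0 \<le> g y \<and> g y \<le> (1::real)) \<and>
    (\<forall>A \<in> past_cylinders k. prob (A \<inter> (ancestral_line Y R (Suc k) -` W \<inter> space M)) =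
       (LINT \<omega>:A|M. g (ancestral_line Y R k \<omega>)))"
proof -
  obtain D B where W: "W = line_box D B" and B: "\<And>n. B n \<in> sets (list_space borel)"
    using W by (auto simp: line_boxes_def)
  \<comment> \<open>\<open>step_prob\<close> can exceed 1 only for a past of probability 0; the minimum makes \<open>g\<close> bounded.\<close>
  define c where "c = (\<lambda>d. if \<exists>b. branching b \<and> discrete_line b k = d \<and> discrete_line b (Suc k) = D
     then min 1 (step_prob d D B) else 0)"
  \<comment> \<open>The indicator tests the weights of crossings common to both lines, which the
    current line already shows; only the fresh crossings contribute to \<open>c\<close>.\<close>
  define g where "g = (\<lambda>y. c (map discrete_part y) *
     indicator (line_box (map discrete_part y) (retained (map discrete_part y) D B)) y)"
  have c01: "0 \<le> c d" "c d \<le> 1" for d using step_prob_nonneg by (auto simp: c_def)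
  have "(\<lambda>y. c d * indicator (line_box d (retained d D B)) y) \<in> borel_measurable line_space" for d
    by (intro borel_measurable_times borel_measurable_const borel_measurable_indicator
        line_box_sets retained_sets B)
  then have "g \<in> borel_measurable line_space"
    unfolding g_def by (rule measurable_compose_countable[OF _ measurable_discrete_parts])
  moreover have "0 \<le> g y \<and> g y \<le> 1" for y using c01 by (auto simp: g_def indicator_def)
  moreover have "prob (A \<inter> (ancestral_line Y R (Suc k) -` W \<inter> space M)) =
       (LINT \<omega>:A|M. g (ancestral_line Y R k \<omega>))" if pc: "A \<in> past_cylinders k" for A
  proof -
    obtain a C where A: "A = cylinder (past_nodes a k) a C" and a: "branching a"
      and C: "\<And>n i. C n i \<in> sets (list_space borel)" using pc by (auto simp: past_cylinders_def)
    define d where "d = discrete_line a k"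
    define Q where "Q = cylinder (past_nodes a k) a (\<lambda>n i. C n i \<inter> index_constraint d (retained d D B) n i)"
    have Q: "A \<inter> (ancestral_line Y R k -` line_box d (retained d D B) \<inter> space M) = Q"
      using cylinder_Int_box[OF a k order.refl, of C d "retained d D B"] by (simp add: A Q_def d_def)
    have Qev: "Q \<in> events"
      unfolding Q_def by (intro cylinder_sets[OF a ancestor_closed_past_nodes[OF a k]] sets.Int C
          index_constraint_sets retained_sets B)
    have "map discrete_part (ancestral_line Y R k \<omega>) = d" if "\<omega> \<in> A" for \<omega>
    proof -
      have w: "\<omega> \<in> space M" "agree a k (forest \<omega>)" using that by (auto simp: A cylinder_iff)
      then show ?thesis
        using discrete_parts_ancestral_line[OF w(1) k]
          agree_discrete_line[OF a branching_forest[OF w(1)] w(2) k order.refl] by (simp add: d_def)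
    qed
    \<comment> \<open>On \<open>A\<close> the discrete part is the constant \<open>d\<close>, so
      there \<open>g\<close> takes the value \<open>c d\<close> on \<open>Q\<close> and 0
      elsewhere.\<close>
    then have "indicator A \<omega> *\<^sub>R g (ancestral_line Y R k \<omega>) = c d * indicator Q \<omega>" for \<omega>
      unfolding Q[symmetric] g_def by (auto simp: indicator_def A cylinder_iff)
    then have "(LINT \<omega>:A|M. g (ancestral_line Y R k \<omega>)) = c d * prob Q"
      unfolding set_lebesgue_integral_def using Qev by simp
    moreover have "prob (A \<inter> (ancestral_line Y R (Suc k) -` W \<inter> space M)) = c d * prob Q"
    proof (cases "\<exists>b. branching b \<and> discrete_line b k = d \<and> discrete_line b (Suc k) = D")
      case True
      then obtain b where b: "branching b" "discrete_line b k = d" "discrete_line b (Suc k) = D" by blast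
      note nxt = a b(1) k d_def[symmetric] b(2,3)
      have Q': "Q = cylinder (past_nodes a k) a (kept_weights d D B C)"
        unfolding Q_def by (simp add: kept_weights_def cylinder_def)
      have 1: "prob (A \<inter> (ancestral_line Y R (Suc k) -` W \<inter> space M)) = step_prob d D B * prob Q"
        unfolding A W Q' by (rule prob_next_box[OF nxt]) (rule B C)+
      have 2: "prob (A \<inter> (ancestral_line Y R (Suc k) -` W \<inter> space M)) \<le> prob Q"
        unfolding A W Q' by (rule prob_next_box_le[OF nxt]) (rule B C)+
      show ?thesis
      proof (cases "step_prob d D B \<le> 1")
        case True
        then show ?thesis using 1 \<open>\<exists>b. _ b\<close> by (simp add: c_def)
      next
        case False
        then have "prob Q = 0"
          using 1 2 mult_strict_right_mono[of 1 "step_prob d D B" "prob Q"] measure_nonneg[of M Q] by linarith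
        then show ?thesis using 1 by simp
      qed
    next
      case False
      have "A \<inter> (ancestral_line Y R (Suc k) -` W \<inter> space M) = {}"
      proof (rule ccontr)
        assume "\<not> ?thesis"
        then obtain \<omega> where w: "\<omega> \<in> A" "\<omega> \<in> space M" "ancestral_line Y R (Suc k) \<omega> \<in> W" by blast
        have "agree a k (forest \<omega>)" using w by (simp add: A cylinder_iff)
        then have "discrete_line (forest \<omega>) k = d"
          using agree_discrete_line[OF a branching_forest[OF w(2)] _ k order.refl] by (simp add: d_def)
        moreover have "discrete_line (forest \<omega>) (Suc k) = D"
          using ancestral_line_in_box[OF w(2), of "Suc k" "Suc k" D B] w(3) W by simp
        ultimately show False using False branching_forest[OF w(2)] by blast
      qed
      moreover have "c d = 0" unfolding c_def using False by (rule if_not_P)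
      ultimately show ?thesis by simp
    qed
    ultimately show ?thesis by simp
  qed
  ultimately show ?thesis by blast
qed

lemma ancestral_line_measurable:
  assumes k: "1 \<le> k"
  shows "ancestral_line Y R k \<in> measurable M line_space"
proof (rule subsetD[OF measurable_mono ancestral_line_measurable_past[OF k order.refl]])
  show "sets (sigma (space M) (past_cylinders k)) \<subseteq> events"
    unfolding sets_past_cylinders using past_cylinders_events[OF k] by (rule sets.sigma_sets_subset)
  show "space (sigma (space M) (past_cylinders k)) = space M" by (rule space_measure_of_conv)
qed auto

lemma markov_ancestral_line: "markov_process M line_space (ancestral_line Y R)"
proof (rule markov_processI[where H = past_cylinders])
  show "line_boxes \<subseteq> Pow (space line_space)" by simp
  show "sets line_space = sigma_sets (space line_space) line_boxes"
    using sets_line_space_boxes by simp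
  show "\<Union> (range (\<lambda>D. line_box D (\<lambda>_. UNIV))) = space line_space"
    using line_boxes_cover(3) by simp
qed (rule ancestral_line_measurable Int_stable_line_boxes line_boxes_cover(1,2) Int_stable_past_cylinders
    past_cylinders_events past_cylinders_cover ancestral_line_measurable_past ancestral_line_step; assumption?)+

end

theorem lemma4p1:
  fixes p :: "orient \<Rightarrow> orient list pmf"
    and F :: "orient \<Rightarrow> orient list \<Rightarrow> real list measure"
    and astar :: real
    and M :: "'w measure"
    and Y :: "real \<Rightarrow> 'w \<Rightarrow> real"
    and R :: "int \<Rightarrow> nat \<Rightarrow> 'w \<Rightarrow> real list"
  assumes "orientation_distributions p"
    and "weight_distributions F"
    and "assumption_I p"
    and "assumption_II p F"
    and "assumption_III p F"
    and "root_up_prob p astar"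
    and "mebp p F astar M Y R"
  shows "markov_process M line_space (ancestral_line Y R)"
proof -
  interpret mebp_process p F astar M Y R
    using assms(1,7) by (intro mebp_process.intro mebp_process_axioms.intro) (simp_all add: mebp_def)
  show ?thesis by (rule markov_ancestral_line)
qed

end
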